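(* Let $T \notin \{P_5, P_6\}$ be a tree of order $n \ge 4$. Then $\gamma_t^d(T) \le 2(n-1)/3$, with equality if and only if $T \in \mathcal{T} \cup \mathcal{F} \cup \{K_{1,3}, T^*\}$.
   Context: For a graph $G$ with no isolated vertex, a set $S \subseteq V(G)$ is a disjunctive total dominating set if every vertex of $G$ either is adjacent to a vertex of $S$ or has at least two vertices of $S$ at distance exactly $2$ from it; $\gamma_t^d(G)$ is the minimum cardinality of such a set. $P_m$ is the path on $m$ vertices. For $k \ge 1$, $T_k$ is the tree obtained from the star $K_{1,k}$ by subdividing every edge exactly twice (so $T_1 = P_4$), and $\mathcal{T} = \{T_k : k \ge 1\}$. For $k \ge 2$, $F_k$ is the tree obtained from $T_k$ by deleting an edge $uv$ incident with the central vertex $v$ of $T_k$ and adding the edge $uw$ for some neighbor $w$ of $v$ different from $u$, and $\mathcal{F} = \{F_k : k \ge 2\}$. $T^*$ is the tree of order $7$ obtained from the star $K_{1,3}$ by subdividing one edge three times. *)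

theory Defs
  imports "Graph_Theory.Graph_Theory"
begin

text \<open>
  Finite simple graphs are the symmetric loop-free digraphs of the locale \<open>pair_graph\<close>: an edge
  \<open>uv\<close> is the pair of arcs \<open>(u, v)\<close>, \<open>(v, u)\<close>.
\<close>

abbreviation graph_iso :: "'a pair_pre_digraph \<Rightarrow> 'b pair_pre_digraph \<Rightarrow> bool" (infix \<open>\<simeq>\<^sub>g\<close> 50) where
  "G \<simeq>\<^sub>g H \<equiv> digraph_iso (with_proj G) (with_proj H)"

text \<open>
  The library constant \<open>tree\<close> is unsuitable for symmetric digraphs: for every edge \<open>uv\<close> the closed
  walk \<open>u, v, u\<close> is a \<open>cycle\<close> of length 2. The cycles of the underlying undirected simple graph are
  exactly those of length at least 3.
\<close>

definition tree_graph :: "'a pair_pre_digraph \<Rightarrow> bool" where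
  "tree_graph G \<longleftrightarrow> pair_graph G \<and> Digraph_Component.connected (with_proj G)
     \<and> \<not> (\<exists>p. pre_digraph.cycle (with_proj G) p \<and> length p \<ge> 3)"

text \<open>Graph distance is the library's shortest-path distance with unit arc weights.\<close>

definition graph_dist :: "'a pair_pre_digraph \<Rightarrow> 'a \<Rightarrow> 'a \<Rightarrow> ereal" where
  "graph_dist G u v = wf_digraph.\<mu> (with_proj G) (\<lambda>_. 1) u v"

definition disj_total_dominating :: "'a pair_pre_digraph \<Rightarrow> 'a set \<Rightarrow> bool" where
  "disj_total_dominating G S \<longleftrightarrow> S \<subseteq> pverts G \<and>
     (\<forall>v \<in> pverts G. (\<exists>s \<in> S. (v, s) \<in> parcs G) \<or> card {s \<in> S. graph_dist G v s = 2} \<ge> 2)"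

text \<open>
  Meaningful for finite graphs without isolated vertices; there the whole vertex set is a disjunctive
  total dominating set, so the minimum is over a nonempty set.
\<close>

definition disj_total_domination_number :: "'a pair_pre_digraph \<Rightarrow> nat" (\<open>\<gamma>\<^sub>t\<^sup>d\<close>) where
  "\<gamma>\<^sub>t\<^sup>d G = (LEAST m. \<exists>S. disj_total_dominating G S \<and> card S = m)"

definition path_graph :: "nat \<Rightarrow> nat pair_pre_digraph" where
  "path_graph m = \<lparr> pverts = {..<m},
     parcs = {(i, j). i < m \<and> j < m \<and> (j = Suc i \<or> i = Suc j)} \<rparr>"

text \<open>The star \<open>K\<^sub>1\<^sub>,\<^sub>k\<close> with centre 0 and leaves \<open>1, \<dots>, k\<close>.\<close>

definition star_graph :: "nat \<Rightarrow> nat pair_pre_digraph" where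
  "star_graph k = \<lparr> pverts = {0..k}, parcs = {0} \<times> {1..k} \<union> {1..k} \<times> {0} \<rparr>"

lemma star_graph_complete_bipartite: "complete_bipartite_digraph 1 k (with_proj (star_graph k))"
  unfolding complete_bipartite_digraph_pair_def star_graph_def
  by (intro conjI exI[of _ "{0}"] exI[of _ "{1..k}"]) auto

text \<open>
  The edge \<open>0i\<close> of the star becomes the path \<open>0, k + i, 2 * k + i, i\<close>; the centre is still 0.
\<close>

definition T_graph :: "nat \<Rightarrow> nat pair_pre_digraph" where
  "T_graph k = fold (\<lambda>i G. subdivide (subdivide G (0, i) (k + i)) (k + i, i) (2 * k + i))
     [1..<Suc k] (star_graph k)"

definition T_family :: "nat pair_pre_digraph set" where
  "T_family = {T_graph k | k. k \<ge> 1}"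

definition replace_edge :: "'a pair_pre_digraph \<Rightarrow> 'a \<Rightarrow> 'a \<Rightarrow> 'a \<Rightarrow> 'a pair_pre_digraph" where
  "replace_edge G u v w = \<lparr> pverts = pverts G,
     parcs = (parcs G - {(u, v), (v, u)}) \<union> {(u, w), (w, u)} \<rparr>"

text \<open>
  All choices of two distinct neighbours \<open>u\<close>, \<open>w\<close> of the centre 0 are admitted; for fixed \<open>k\<close> they
  yield isomorphic graphs.
\<close>

definition F_family :: "nat pair_pre_digraph set" where
  "F_family = {replace_edge (T_graph k) u 0 w | k u w.
     k \<ge> 2 \<and> (u, 0) \<in> parcs (T_graph k) \<and> (w, 0) \<in> parcs (T_graph k) \<and> w \<noteq> u}"

definition T_ast :: "nat pair_pre_digraph" where
  "T_ast = subdivide (subdivide (subdivide (star_graph 3) (0, 1) 4) (4, 1) 5) (5, 1) 6"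

lemma T_graph_explicit:
  "pverts (T_graph k) = {0..3 * k}"
  "parcs (T_graph k) = (\<Union>i \<in> {1..k}. {(0, k + i), (k + i, 0), (k + i, 2 * k + i),
      (2 * k + i, k + i), (2 * k + i, i), (i, 2 * k + i)})"
proof -
  define step where "step = (\<lambda>i G. subdivide (subdivide G (0::nat, i) (k + i)) (k + i, i) (2 * k + i))"
  have step: "pverts (fold step [1..<Suc m] (star_graph k)) = {0..k + m} \<union> {2 * k + 1..2 * k + m} \<and>
      parcs (fold step [1..<Suc m] (star_graph k)) = {0} \<times> {m+1..k} \<union> {m+1..k} \<times> {0} \<union>
       (\<Union>i \<in> {1..m}. {(0, k + i), (k + i, 0), (k + i, 2 * k + i),
      (2 * k + i, k + i), (2 * k + i, i), (i, 2 * k + i)})" if "m \<le> k" for m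
    using that
  proof (induction m)
    case 0
    then show ?case by (simp add: star_graph_def)
  next
    case (Suc m)
    define G where "G = fold step [1..<Suc m] (star_graph k)"
    have eq: "fold step [1..<Suc (Suc m)] (star_graph k) = step (Suc m) G"
      by (simp add: G_def)
    have iv: "{1..Suc m} = insert (Suc m) {1..m}" by auto
    have iv2: "{m+1..k} = insert (Suc m) {Suc m + 1..k}" using Suc.prems by auto
    define A where "A = (\<Union>i \<in> {1..m}. {(0, k + i), (k + i, 0), (k + i, 2 * k + i),
      (2 * k + i, k + i), (2 * k + i, i), (i, 2 * k + i)})"
    have notA: "(0, Suc m) \<notin> A" "(Suc m, 0) \<notin> A"
        "(k + Suc m, Suc m) \<notin> A" "(Suc m, k + Suc m) \<notin> A"
      using Suc.prems by (auto simp: A_def)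
    have IH: "pverts G = {0..k + m} \<union> {2 * k + 1..2 * k + m}"
        "parcs G = {0} \<times> {m+1..k} \<union> {m+1..k} \<times> {0} \<union> A"
      using Suc unfolding A_def G_def by auto
    have "pverts (step (Suc m) G) = {0..k + Suc m} \<union> {2 * k + 1..2 * k + Suc m}"
      unfolding step_def verts_subdivide IH using Suc.prems by auto
    moreover have "parcs (step (Suc m) G) = {0} \<times> {Suc m+1..k} \<union> {Suc m+1..k} \<times> {0} \<union>
       ({(0, k + Suc m), (k + Suc m, 0), (k + Suc m, 2 * k + Suc m),
      (2 * k + Suc m, k + Suc m), (2 * k + Suc m, Suc m), (Suc m, 2 * k + Suc m)} \<union> A)"
      unfolding step_def arcs_subdivide IH iv2 using notA Suc.prems by fastforce
    ultimately show ?case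
      unfolding eq iv A_def UN_insert by blast
  qed
  show "pverts (T_graph k) = {0..3 * k}"
    using step[of k] by (auto simp: T_graph_def step_def)
  show "parcs (T_graph k) = (\<Union>i \<in> {1..k}. {(0, k + i), (k + i, 0), (k + i, 2 * k + i),
      (2 * k + i, k + i), (2 * k + i, i), (i, 2 * k + i)})"
    using step[of k] by (simp add: T_graph_def step_def)
qed

end

theory Submission
  imports Defs
begin

text \<open>
  Every tree with at least two vertices arises from single vertices by hanging the root of one rooted
  tree below the root of another, and may be rooted at a leaf. For a rooted tree \<open>t\<close> with \<open>n\<close> vertices
  and a type of partial solution at the root, consider the least value of \<open>3|S| - 2n\<close> over the sets
  \<open>S\<close> of that type. Up to weakening, these vectors of values take only twenty values, so they are the
  states of a finite tree automaton. Reading off its final values gives \<open>3\<gamma> - 2n \<le> -2\<close> for all trees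
  other than \<open>P\<^sub>5\<close> and \<open>P\<^sub>6\<close>, and the value \<open>-2\<close> occurs only in the few states whose trees can be listed:
  they are the claimed extremal trees. Conversely, in \<open>T\<^sub>k\<close> and \<open>F\<^sub>k\<close> every leg (in \<open>F\<^sub>k\<close>, one of them
  together with the centre) must contain two vertices of a disjunctive total dominating set.
\<close>

section \<open>Rooted trees and disjunctive total domination\<close>

text \<open>Deleting a pendant piece and inducting on the rest is awkward: the rest may be
  \<open>P_5\<close> or \<open>P_6\<close>, where the bound fails, and equality must be traced
  through infinite families. The automaton instead records how each choice at the root behaves when
  more is attached. The quantity \<open>3|S| - 2n\<close> is additive under \<open>Jn\<close>. A
  path on three vertices attached with two of them in \<open>S\<close> contributes 0, so legs can be
  added in a loop of the automaton without changing the value; this is the source of the infinite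
  families. Few numbers suffice at the root because domination looks only two steps far. The
  recorded values are only upper bounds, so weakening a vector is harmless. Classes are separated
  from vectors: the class is a function of the tree, so that extremal trees can be recognised, while
  a class may leave open which of several vectors applies.\<close>

text \<open>\<open>Jn s t\<close> makes the root of \<open>t\<close> a child of the root of \<open>s\<close>.\<close>

datatype 'a rtree = Lf 'a | Jn "'a rtree" "'a rtree"

primrec apex :: "'a rtree \<Rightarrow> 'a" where
  "apex (Lf a) = a"
| "apex (Jn s t) = apex s"

primrec rverts :: "'a rtree \<Rightarrow> 'a set" where
  "rverts (Lf a) = {a}"
| "rverts (Jn s t) = rverts s \<union> rverts t"

primrec rarcs :: "'a rtree \<Rightarrow> 'a rel" where
  "rarcs (Lf a) = {}"
| "rarcs (Jn s t) = rarcs s \<union> rarcs t \<union> {(apex s, apex t), (apex t, apex s)}"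

primrec wft :: "'a rtree \<Rightarrow> bool" where
  "wft (Lf a) \<longleftrightarrow> True"
| "wft (Jn s t) \<longleftrightarrow> wft s \<and> wft t \<and> rverts s \<inter> rverts t = {}"

lemma apex_in_rverts: "apex t \<in> rverts t"
  by (induction t) auto

lemma finite_rverts [simp]: "finite (rverts t)"
  by (induction t) auto

lemma rarcs_in_rverts: "(u, v) \<in> rarcs t \<Longrightarrow> u \<in> rverts t \<and> v \<in> rverts t"
  by (induction t) (auto simp: apex_in_rverts)

lemma sym_rarcs: "(u, v) \<in> rarcs t \<Longrightarrow> (v, u) \<in> rarcs t"
  by (induction t) auto

section \<open>Domination within two steps and the counts at the root\<close>

definition two_steps :: "'a rel \<Rightarrow> 'a \<Rightarrow> 'a set" where
  "two_steps E v = {s. s \<noteq> v \<and> (\<exists>w. (v, w) \<in> E \<and> (w, s) \<in> E)}"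

definition dominated :: "'a rel \<Rightarrow> 'a set \<Rightarrow> 'a \<Rightarrow> bool" where
  "dominated E S v \<longleftrightarrow> (\<exists>s \<in> S. (v, s) \<in> E) \<or> 2 \<le> card (S \<inter> two_steps E v)"

lemma two_steps_mono: "E \<subseteq> F \<Longrightarrow> two_steps E v \<subseteq> two_steps F v"
  unfolding two_steps_def by blast

lemma dominated_mono:
  assumes "dominated E S v" "E \<subseteq> F" "finite S"
  shows "dominated F S v"
proof -
  have "card (S \<inter> two_steps E v) \<le> card (S \<inter> two_steps F v)"
    using assms two_steps_mono[OF assms(2)] by (intro card_mono) auto
  then show ?thesis using assms unfolding dominated_def by fastforce
qed

primrec children_in :: "'a set \<Rightarrow> 'a rtree \<Rightarrow> nat" where
  "children_in S (Lf a) = 0"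
| "children_in S (Jn s t) = children_in S s + of_bool (apex t \<in> S)"

primrec grandchildren_in :: "'a set \<Rightarrow> 'a rtree \<Rightarrow> nat" where
  "grandchildren_in S (Lf a) = 0"
| "grandchildren_in S (Jn s t) = grandchildren_in S s + children_in S t"

text \<open>
  A child of the root without a neighbour in \<open>S\<close> sees at distance 2 its own grandchildren and the
  other neighbours of the root. The \<open>demand\<close> is the number of neighbours of the root that must lie
  in \<open>S\<close> (children, and possibly a future parent) for all children to be dominated.
\<close>

primrec demand :: "'a set \<Rightarrow> 'a rtree \<Rightarrow> nat" where
  "demand S (Lf a) = 0"
| "demand S (Jn s t) = max (demand S s)
     (if apex s \<in> S \<or> 0 < children_in S t \<or> 2 \<le> grandchildren_in S t then 0
      else 2 + of_bool (apex t \<in> S) - grandchildren_in S t)"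

text \<open>Once \<open>t\<close> hangs below \<open>s\<close>, the neighbours of
  \<open>apex t\<close> are final: its children and \<open>apex s\<close>. Hence the demand at
  \<open>apex t\<close> is settled at this join, while the one at \<open>apex s\<close> stays
  open.\<close>

primrec below_dominated :: "'a set \<Rightarrow> 'a rtree \<Rightarrow> bool" where
  "below_dominated S (Lf a) \<longleftrightarrow> True"
| "below_dominated S (Jn s t) \<longleftrightarrow> below_dominated S s \<and> below_dominated S t \<and>
     demand S t \<le> children_in S t + of_bool (apex s \<in> S)"

lemma local_cong:
  assumes "S \<inter> rverts t = S' \<inter> rverts t"
  shows children_in_cong: "children_in S t = children_in S' t"
    and grandchildren_in_cong: "grandchildren_in S t = grandchildren_in S' t"
    and demand_cong: "demand S t = demand S' t"
    and below_dominated_cong: "below_dominated S t \<longleftrightarrow> below_dominated S' t"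
proof -
  have "children_in S t = children_in S' t \<and> grandchildren_in S t = grandchildren_in S' t \<and>
    demand S t = demand S' t \<and> (below_dominated S t \<longleftrightarrow> below_dominated S' t)"
    using assms
  proof (induction t)
    case (Jn s t)
    have "S \<inter> rverts s = S' \<inter> rverts s" "S \<inter> rverts t = S' \<inter> rverts t"
      using Jn.prems by auto
    moreover have "apex s \<in> S \<longleftrightarrow> apex s \<in> S'" "apex t \<in> S \<longleftrightarrow> apex t \<in> S'"
      using Jn.prems apex_in_rverts[of s] apex_in_rverts[of t] by auto
    ultimately show ?case using Jn.IH by simp
  qed simp
  then show "children_in S t = children_in S' t" "grandchildren_in S t = grandchildren_in S' t"
    "demand S t = demand S' t" "below_dominated S t \<longleftrightarrow> below_dominated S' t"
    by auto
qed

lemma card_neighbours_ge: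
  assumes "wft t" "finite S"
  shows "children_in S t \<le> card {s \<in> S. (apex t, s) \<in> rarcs t}"
  using assms
proof (induction t)
  case (Jn s t)
  have 1: "(apex s, apex t) \<notin> rarcs s"
    using Jn.prems rarcs_in_rverts[of _ _ s] apex_in_rverts[of t] by fastforce
  have sub: "{x \<in> S. (apex s, x) \<in> rarcs s} \<union> (if apex t \<in> S then {apex t} else {})
      \<subseteq> {x \<in> S. (apex s, x) \<in> rarcs (Jn s t)}"
    by auto
  have "card ({x \<in> S. (apex s, x) \<in> rarcs s} \<union> (if apex t \<in> S then {apex t} else {})) =
     card {x \<in> S. (apex s, x) \<in> rarcs s} + of_bool (apex t \<in> S)"
    using 1 Jn.prems by auto
  then have "card {x \<in> S. (apex s, x) \<in> rarcs s} + of_bool (apex t \<in> S) \<le>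
      card {x \<in> S. (apex s, x) \<in> rarcs (Jn s t)}"
    using card_mono[OF _ sub] Jn.prems(2) by simp
  moreover have "children_in S s \<le> card {x \<in> S. (apex s, x) \<in> rarcs s}" using Jn by simp
  ultimately show ?case unfolding children_in.simps apex.simps by linarith
qed simp

lemma card_two_steps_root_ge:
  assumes "wft t" "finite S"
  shows "grandchildren_in S t \<le> card (S \<inter> two_steps (rarcs t) (apex t))"
  using assms
proof (induction t)
  case (Jn s t)
  let ?A = "S \<inter> two_steps (rarcs s) (apex s)" and ?B = "{x \<in> S. (apex t, x) \<in> rarcs t}"
  have A: "?A \<subseteq> rverts s" and B: "?B \<subseteq> rverts t"
    using rarcs_in_rverts unfolding two_steps_def by fastforce+
  have "?A \<union> ?B \<subseteq> S \<inter> two_steps (rarcs (Jn s t)) (apex s)"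
    using B Jn.prems apex_in_rverts[of s] unfolding two_steps_def by auto
  moreover have "card (?A \<union> ?B) = card ?A + card ?B"
    using A B Jn.prems by (intro card_Un_disjoint) auto
  ultimately show ?case
    using Jn card_neighbours_ge[of t S] card_mono[of "S \<inter> two_steps (rarcs (Jn s t)) (apex s)" "?A \<union> ?B"]
    by fastforce
qed simp

text \<open>The second alternative is the invariant of a child \<open>v\<close> of the root that is
  still waiting. A further child of the root in \<open>S\<close> raises the left side by 1 and the
  right side by at least 1. Once the neighbours of the root in \<open>S\<close> reach the demand, at
  least 2 vertices of \<open>S\<close> are two steps from \<open>v\<close>. If \<open>v\<close>
  itself lies in \<open>S\<close>, it is among the children counted but not two steps from itself,
  which is why its demand is then larger by 1.\<close>

lemma below_dominated_imp:
  assumes "wft t" "finite S" "below_dominated S t" "v \<in> rverts t" "v \<noteq> apex t"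
  shows "dominated (rarcs t) S v \<or> (apex t, v) \<in> rarcs t \<and>
    2 + children_in S t \<le> card (S \<inter> two_steps (rarcs t) v) + demand S t"
  using assms
proof (induction t arbitrary: v)
  case (Jn s t)
  let ?E = "rarcs (Jn s t)"
  have Es: "rarcs s \<subseteq> ?E" and Et: "rarcs t \<subseteq> ?E" by auto
  have disj: "rverts s \<inter> rverts t = {}" using Jn.prems by auto
  have rs: "apex s \<in> rverts s" and rt: "apex t \<in> rverts t" by (rule apex_in_rverts)+
  show ?case
  proof (cases "v \<in> rverts s")
    case True
    then have "dominated (rarcs s) S v \<or> (apex s, v) \<in> rarcs s \<and>
        2 + children_in S s \<le> card (S \<inter> two_steps (rarcs s) v) + demand S s"
      using Jn.IH(1)[of v] Jn.prems by auto
    then show ?thesis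
    proof
      assume "dominated (rarcs s) S v"
      then show ?thesis using dominated_mono[OF _ Es] Jn.prems by blast
    next
      assume *: "(apex s, v) \<in> rarcs s \<and>
        2 + children_in S s \<le> card (S \<inter> two_steps (rarcs s) v) + demand S s"
      let ?A = "S \<inter> two_steps (rarcs s) v"
      have "?A \<subseteq> rverts s" using rarcs_in_rverts unfolding two_steps_def by fastforce
      then have "apex t \<notin> ?A" using rt disj by blast
      then have c: "card (?A \<union> (if apex t \<in> S then {apex t} else {})) = card ?A + of_bool (apex t \<in> S)"
        using Jn.prems(2) by simp
      have "?A \<union> (if apex t \<in> S then {apex t} else {}) \<subseteq> S \<inter> two_steps ?E v"
        using * sym_rarcs[of "apex s" v s] True rt disj unfolding two_steps_def by auto
      then have "card ?A + of_bool (apex t \<in> S) \<le> card (S \<inter> two_steps ?E v)"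
        using c card_mono[of "S \<inter> two_steps ?E v"] Jn.prems(2) by (metis finite_Int)
      then show ?thesis using * by auto
    qed
  next
    case False
    then have vt: "v \<in> rverts t" using Jn.prems by auto
    show ?thesis
    proof (cases "v = apex t")
      case True
      show ?thesis
      proof (cases "apex s \<in> S \<or> 0 < children_in S t \<or> 2 \<le> grandchildren_in S t")
        case T: True
        then consider "apex s \<in> S" | "0 < children_in S t" | "2 \<le> grandchildren_in S t" by auto
        then have "dominated ?E S v"
        proof cases
          case 1 then show ?thesis using True unfolding dominated_def by auto
        next
          case 2
          then have "card {x \<in> S. (apex t, x) \<in> rarcs t} > 0"
            using card_neighbours_ge[of t S] Jn.prems by auto
          then have "{x \<in> S. (apex t, x) \<in> rarcs t} \<noteq> {}" by (metis card.empty less_irrefl)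
          then show ?thesis using True unfolding dominated_def by auto
        next
          case 3
          then have "dominated (rarcs t) S v"
            using card_two_steps_root_ge[of t S] Jn.prems True unfolding dominated_def by auto
          then show ?thesis using dominated_mono[OF _ Et] Jn.prems by blast
        qed
        then show ?thesis by blast
      next
        case F: False
        let ?A = "{x \<in> S. (apex s, x) \<in> rarcs s}" and ?B = "S \<inter> two_steps (rarcs t) (apex t)"
        have A: "?A \<subseteq> rverts s" and B: "?B \<subseteq> rverts t"
          using rarcs_in_rverts unfolding two_steps_def by fastforce+
        have "?A \<union> ?B \<subseteq> S \<inter> two_steps ?E v"
          using True A rt disj unfolding two_steps_def by auto
        moreover have "card (?A \<union> ?B) = card ?A + card ?B"
          using A B Jn.prems disj by (intro card_Un_disjoint) auto
        ultimately have "card ?A + card ?B \<le> card (S \<inter> two_steps ?E v)"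
          using card_mono[of "S \<inter> two_steps ?E v" "?A \<union> ?B"] Jn.prems by auto
        moreover have "children_in S s \<le> card ?A" "grandchildren_in S t \<le> card ?B"
          using card_neighbours_ge[of s S] card_two_steps_root_ge[of t S] Jn.prems by auto
        ultimately show ?thesis using F True by auto
      qed
    next
      case ne: False
      then have "dominated (rarcs t) S v \<or> (apex t, v) \<in> rarcs t \<and>
        2 + children_in S t \<le> card (S \<inter> two_steps (rarcs t) v) + demand S t"
        using Jn.IH(2)[of v] vt Jn.prems by auto
      then have "dominated ?E S v"
      proof
        assume "dominated (rarcs t) S v"
        then show ?thesis using dominated_mono[OF _ Et] Jn.prems by blast
      next
        assume *: "(apex t, v) \<in> rarcs t \<and>
          2 + children_in S t \<le> card (S \<inter> two_steps (rarcs t) v) + demand S t"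
        let ?A = "S \<inter> two_steps (rarcs t) v"
        have "?A \<subseteq> rverts t" using rarcs_in_rverts unfolding two_steps_def by fastforce
        then have "apex s \<notin> ?A" using rs disj by blast
        then have c: "card (?A \<union> (if apex s \<in> S then {apex s} else {})) = card ?A + of_bool (apex s \<in> S)"
          using Jn.prems(2) by simp
        have "?A \<union> (if apex s \<in> S then {apex s} else {}) \<subseteq> S \<inter> two_steps ?E v"
          using * sym_rarcs[of "apex t" v t] vt rs disj unfolding two_steps_def by auto
        then have "card ?A + of_bool (apex s \<in> S) \<le> card (S \<inter> two_steps ?E v)"
          using c card_mono[of "S \<inter> two_steps ?E v"] Jn.prems(2) by (metis finite_Int)
        moreover have "demand S t \<le> children_in S t + of_bool (apex s \<in> S)"
          using Jn.prems by auto
        ultimately show ?thesis using * unfolding dominated_def by linarith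
      qed
      then show ?thesis by blast
    qed
  qed
qed simp

text \<open>
  A profile \<open>(i, c, d, m)\<close> records what is guaranteed about \<open>S\<close> at the root: membership of the root,
  lower bounds \<open>c\<close>, \<open>d\<close> for the children and grandchildren in \<open>S\<close>, and an upper bound \<open>m\<close> for the
  demand. The bound on \<open>d\<close> is void once a child is in \<open>S\<close>, and that on \<open>m\<close> once the demand is met.
\<close>

type_synonym profile = "bool \<times> nat \<times> nat \<times> nat"

fun fits :: "profile \<Rightarrow> 'a rtree \<Rightarrow> 'a set \<Rightarrow> bool" where
  "fits (i, c, d, m) t S \<longleftrightarrow> below_dominated S t \<and> (apex t \<in> S \<longleftrightarrow> i) \<and> c \<le> children_in S t \<and>
     (d \<le> grandchildren_in S t \<or> 0 < children_in S t) \<and>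
     (demand S t \<le> m \<or> demand S t \<le> children_in S t)"

text \<open>\<open>Jn\<close> carried out on guaranteed numbers alone, so that it can be evaluated.
  The inequalities towards the third profile allow it to promise less than is known.\<close>

fun joins :: "profile \<Rightarrow> profile \<Rightarrow> profile \<Rightarrow> bool" where
  "joins (i, c, d, m) (j, e, f, k) (i', c', d', m') \<longleftrightarrow>
     (let x = c + (if j then 1 else 0);
          r = max m (if i \<or> 1 \<le> e \<or> 2 \<le> f then 0 else 2 + (if j then 1 else 0) - f)
      in i' = i \<and> c' \<le> x \<and> (d' \<le> d + e \<or> 1 \<le> x) \<and> k \<le> e + (if i then 1 else 0) \<and> (r \<le> m' \<or> r \<le> x))"

lemma fits_cong:
  assumes "S \<inter> rverts t = S' \<inter> rverts t"
  shows "fits p t S \<longleftrightarrow> fits p t S'"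
proof -
  have "apex t \<in> S \<longleftrightarrow> apex t \<in> S'" using assms apex_in_rverts[of t] by auto
  then show ?thesis using local_cong[OF assms] by (cases p) simp
qed

lemma fits_Jn:
  assumes "fits p s S" "fits q t S" "joins p q r"
  shows "fits r (Jn s t) S"
proof -
  obtain i c d m where p: "p = (i, c, d, m)" by (cases p)
  obtain j e f k where q: "q = (j, e, f, k)" by (cases q)
  obtain i' c' d' m' where r: "r = (i', c', d', m')" by (cases r)
  let ?n = "if i \<or> 1 \<le> e \<or> 2 \<le> f then 0 else 2 + (if j then 1 else 0) - f :: nat"
  let ?a = "if apex s \<in> S \<or> 0 < children_in S t \<or> 2 \<le> grandchildren_in S t then 0
      else 2 + of_bool (apex t \<in> S) - grandchildren_in S t :: nat"
  let ?J = "if j then 1 else 0 :: nat" and ?I = "if i then 1 else 0 :: nat"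
  have P: "below_dominated S s" "apex s \<in> S \<longleftrightarrow> i" "c \<le> children_in S s"
      "d \<le> grandchildren_in S s \<or> 0 < children_in S s" "demand S s \<le> m \<or> demand S s \<le> children_in S s"
    using assms(1) unfolding p by simp_all
  have Q: "below_dominated S t" "apex t \<in> S \<longleftrightarrow> j" "e \<le> children_in S t"
      "f \<le> grandchildren_in S t \<or> 0 < children_in S t" "demand S t \<le> k \<or> demand S t \<le> children_in S t"
    using assms(2) unfolding q by simp_all
  have R: "i' = i" "c' \<le> c + ?J" "d' \<le> d + e \<or> 1 \<le> c + ?J" "k \<le> e + ?I"
      "max m ?n \<le> m' \<or> max m ?n \<le> c + ?J"
    using assms(3) unfolding p q r joins.simps Let_def by blast+
  have b: "of_bool (apex t \<in> S) = ?J" "of_bool (apex s \<in> S) = ?I" using P(2) Q(2) by simp_all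
  \<comment> \<open>The demand of \<open>apex t\<close> can only fall when the counts in
    \<open>t\<close> grow, so the lower bounds overestimate it. A void bound \<open>f\<close> means
    a child in \<open>S\<close>, and then it is 0.\<close>
  have "?a \<le> ?n" using P(2) Q(2,3,4) by auto
  then have "max (demand S s) ?a \<le> m' \<or> max (demand S s) ?a \<le> children_in S s + ?J"
    using P(3,5) R(5) by linarith
  moreover have "demand S t \<le> children_in S t + ?I" using Q(3,5) R(4) by linarith
  moreover have "c' \<le> children_in S s + ?J" using P(3) R(2) by linarith
  moreover have "d' \<le> grandchildren_in S s + children_in S t \<or> 0 < children_in S s + ?J"
    using P(3,4) Q(3) R(3) by linarith
  ultimately show ?thesis
    using P(1,2) Q(1) R(1) unfolding r fits.simps children_in.simps grandchildren_in.simps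
      demand.simps below_dominated.simps apex.simps b by blast
qed

text \<open>No parent follows at the end: the bound 0 on the demand says that the children of the
  root meet it alone. The bound 2 on the grandchildren, or a child in \<open>S\<close> in its place,
  dominates the root itself.\<close>

lemma fits_final_dominated:
  assumes "wft t" "finite S" "fits (i, 0, 2, 0) t S" "v \<in> rverts t"
  shows "dominated (rarcs t) S v"
proof (cases "v = apex t")
  case True
  from assms(3) consider "0 < children_in S t" | "2 \<le> grandchildren_in S t" by auto
  then show ?thesis
  proof cases
    case 1
    then have "{x \<in> S. (apex t, x) \<in> rarcs t} \<noteq> {}"
      using card_neighbours_ge[OF assms(1,2)] by (metis card.empty leD)
    then show ?thesis using True unfolding dominated_def by auto
  next
    case 2
    then show ?thesis
      using card_two_steps_root_ge[OF assms(1,2)] True unfolding dominated_def by auto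
  qed
next
  case False
  then show ?thesis
    using below_dominated_imp[OF assms(1,2) _ assms(4)] assms(3) unfolding dominated_def by fastforce
qed

section \<open>A finite automaton on rooted trees\<close>

text \<open>
  The classes of rooted trees that matter below a leaf of an extremal tree, or of \<open>P\<^sub>5\<close> or \<open>P\<^sub>6\<close>:
  paths hung at an end; a root with two leaves; a root carrying \<open>P\<^sub>2\<close> and \<open>P\<^sub>3\<close> (\<open>Fork\<close>); a root
  carrying at least two paths \<open>P\<^sub>3\<close> (\<open>Hub\<close>); a pendant edge above a \<open>Hub\<close>; a root carrying paths
  \<open>P\<^sub>3\<close> and one \<open>Fork\<close>. The trees in \<open>Missing1\<close>, \<open>Missing2\<close>, \<open>Missing3\<close> become extremal when a
  path of that many vertices is put on top of the root. Everything else is in \<open>Other\<close>.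
\<close>

datatype shape = Other | Path1 | Path2 | Path3 | Path4 | Path5 | Cherry | Fork | Hub | HubEdge
  | ForkHub | Missing1 | Missing2 | Missing3

fun shape_join :: "shape \<Rightarrow> shape \<Rightarrow> shape" where
  "shape_join Path1 b = (case b of Path1 \<Rightarrow> Path2 | Path2 \<Rightarrow> Path3 | Path3 \<Rightarrow> Path4 | Path4 \<Rightarrow> Path5
     | Path5 \<Rightarrow> Missing1 | Cherry \<Rightarrow> Missing3 | Fork \<Rightarrow> ForkHub | Hub \<Rightarrow> HubEdge | HubEdge \<Rightarrow> Missing1
     | ForkHub \<Rightarrow> Missing2 | Missing3 \<Rightarrow> Missing2 | Missing2 \<Rightarrow> Missing1 | _ \<Rightarrow> Other)"
| "shape_join Path2 b = (case b of Path1 \<Rightarrow> Cherry | Path2 \<Rightarrow> Missing3 | Path3 \<Rightarrow> Missing2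
     | Path4 \<Rightarrow> Missing1 | _ \<Rightarrow> Other)"
| "shape_join Path3 b = (case b of Path1 \<Rightarrow> Missing3 | Path3 \<Rightarrow> Fork | Path4 \<Rightarrow> Missing3
     | Hub \<Rightarrow> Missing3 | _ \<Rightarrow> Other)"
| "shape_join Path4 b = (case b of Path1 \<Rightarrow> Missing2 | Path2 \<Rightarrow> Fork | Path3 \<Rightarrow> Hub
     | Path4 \<Rightarrow> Missing2 | Fork \<Rightarrow> ForkHub | Hub \<Rightarrow> Missing2 | _ \<Rightarrow> Other)"
| "shape_join Path5 b = (case b of Path1 \<Rightarrow> Missing1 | Path2 \<Rightarrow> Missing3 | Path3 \<Rightarrow> Missing2
     | _ \<Rightarrow> Other)"
| "shape_join Hub b = (case b of Path3 \<Rightarrow> Hub | Fork \<Rightarrow> ForkHub | _ \<Rightarrow> Other)"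
| "shape_join HubEdge b = (case b of Path2 \<Rightarrow> Missing3 | Path3 \<Rightarrow> Missing2 | _ \<Rightarrow> Other)"
| "shape_join ForkHub b = (case b of Path3 \<Rightarrow> ForkHub | _ \<Rightarrow> Other)"
| "shape_join _ b = Other"

primrec shape_of :: "'a rtree \<Rightarrow> shape" where
  "shape_of (Lf a) = Path1"
| "shape_of (Jn s t) = shape_join (shape_of s) (shape_of t)"

text \<open>
  For each class a list of alternatives. An alternative is a list of profiles with costs: profile
  \<open>p\<close> with cost \<open>x\<close> promises a set \<open>S\<close> that fits \<open>p\<close> with \<open>3|S| \<le> 2n + x\<close>. The lists were found by
  closing the exact min-plus vectors of small trees under \<open>Jn\<close> and weakening the result.
\<close>

fun promises :: "shape \<Rightarrow> (profile \<times> int) list list" where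
  "promises Other =
     [[((False,3,2,0),-3)],
      [((False,0,0,1),-5), ((True,0,2,0),-2)],
      [((False,1,2,2),-5), ((True,1,2,0),-2)],
      [((False,2,2,3),-4), ((True,2,2,0),-1)],
      [((True,0,0,0),-4)],
      [((True,0,2,0),-3)]]"
| "promises Path1 = [[((False,0,0,0),-2), ((True,0,0,0),1)]]"
| "promises Path2 = [[((False,0,0,2),-4), ((True,0,0,0),-1), ((True,1,2,0),2)]]"
| "promises Path3 = [[((False,1,2,0),0), ((False,1,2,3),-3), ((True,1,2,0),0)]]"
| "promises Path4 = [[((False,1,2,0),-2), ((True,1,2,0),1)]]"
| "promises Path5 = [[((False,0,1,0),-4), ((False,1,2,0),-1), ((True,0,1,0),-1)]]"
| "promises Cherry = [[((True,0,0,0),-3)]]"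
| "promises Fork = [[((False,2,2,3),-3), ((True,2,2,0),0)]]"
| "promises Hub = [[((False,2,2,0),-2), ((True,2,2,0),1)]]"
| "promises HubEdge = [[((False,0,2,0),-4), ((True,0,2,0),-1)]]"
| "promises ForkHub = [[((True,0,2,0),-2)]]"
| "promises Missing1 = [[((False,0,1,0),-3), ((True,0,0,0),-3)], [((True,0,1,0),-3)]]"
| "promises Missing2 = [[((False,1,2,2),-4), ((True,1,2,0),-1)]]"
| "promises Missing3 = [[((False,1,2,3),-5), ((True,1,2,0),-2)]]"

definition covers ::
  "(profile \<times> int) list \<Rightarrow> (profile \<times> int) list \<Rightarrow> (profile \<times> int) list \<Rightarrow> bool" where
  "covers P Q R \<longleftrightarrow> (\<forall>(r, z) \<in> set R. \<exists>(p, x) \<in> set P. \<exists>(q, y) \<in> set Q. x + y \<le> z \<and> joins p q r)"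

definition closed_at :: "shape \<Rightarrow> shape \<Rightarrow> bool" where
  "closed_at a b \<longleftrightarrow> (\<forall>P \<in> set (promises a). \<forall>Q \<in> set (promises b).
     \<exists>R \<in> set (promises (shape_join a b)). covers P Q R)"

definition shapes :: "shape list" where
  "shapes = [Other, Path1, Path2, Path3, Path4, Path5, Cherry, Fork, Hub, HubEdge, ForkHub,
     Missing1, Missing2, Missing3]"

lemma in_shapes: "a \<in> set shapes"
  by (cases a) (simp_all add: shapes_def)

text \<open>A finite check over all 196 pairs of classes. It replaces the case analysis on how the
  pieces of a tree fit together and supplies the inductive step of
  \<open>promises_kept\<close>.\<close>

lemma promises_closed: "closed_at a b"
proof -
  have "list_all (\<lambda>a. list_all (closed_at a) shapes) shapes" by code_simp
  then show ?thesis using in_shapes unfolding list_all_iff by blast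
qed

section \<open>Soundness of the promises\<close>

definition kept :: "'a rtree \<Rightarrow> profile \<Rightarrow> int \<Rightarrow> bool" where
  "kept t p x \<longleftrightarrow> (\<exists>S \<subseteq> rverts t. fits p t S \<and> 3 * int (card S) \<le> 2 * int (card (rverts t)) + x)"

lemma kept_Jn:
  assumes "wft (Jn s t)" "kept s p x" "kept t q y" "joins p q r" "x + y \<le> z"
  shows "kept (Jn s t) r z"
proof -
  obtain S where S: "S \<subseteq> rverts s" "fits p s S" "3 * int (card S) \<le> 2 * int (card (rverts s)) + x"
    using assms(2) unfolding kept_def by auto
  obtain S' where S': "S' \<subseteq> rverts t" "fits q t S'" "3 * int (card S') \<le> 2 * int (card (rverts t)) + y"
    using assms(3) unfolding kept_def by auto
  have disj: "rverts s \<inter> rverts t = {}" using assms(1) by simp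
  have "fits p s (S \<union> S')" "fits q t (S \<union> S')"
    using S S' disj fits_cong[of "S \<union> S'" s S p] fits_cong[of "S \<union> S'" t S' q] by blast+
  then have "fits r (Jn s t) (S \<union> S')" using assms(4) fits_Jn by blast
  moreover have "card (S \<union> S') = card S + card S'"
    using S S' disj by (intro card_Un_disjoint) (auto intro: finite_subset[OF _ finite_rverts])
  moreover have "card (rverts (Jn s t)) = card (rverts s) + card (rverts t)"
    using disj by (simp add: card_Un_disjoint)
  ultimately show ?thesis
    using S S' assms(5) unfolding kept_def by (intro exI[of _ "S \<union> S'"]) auto
qed

lemma promises_kept:
  assumes "wft t"
  shows "\<exists>P \<in> set (promises (shape_of t)). \<forall>(p, x) \<in> set P. kept t p x"
  using assms
proof (induction t)
  case (Lf a)
  have "kept (Lf a) (False, 0, 0, 0) (-2)"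
    unfolding kept_def by (intro exI[of _ "{}"]) simp
  moreover have "kept (Lf a) (True, 0, 0, 0) 1"
    unfolding kept_def by (intro exI[of _ "{a}"]) simp
  ultimately show ?case by simp
next
  case (Jn s t)
  then obtain P Q where P: "P \<in> set (promises (shape_of s))" "\<forall>(p, x) \<in> set P. kept s p x"
    and Q: "Q \<in> set (promises (shape_of t))" "\<forall>(q, y) \<in> set Q. kept t q y" by auto
  obtain R where R: "R \<in> set (promises (shape_of (Jn s t)))" "covers P Q R"
    using promises_closed[of "shape_of s" "shape_of t"] P(1) Q(1) unfolding closed_at_def by auto
  have "kept (Jn s t) r z" if rz: "(r, z) \<in> set R" for r z
  proof -
    obtain p x q y where "(p, x) \<in> set P" "(q, y) \<in> set Q" "x + y \<le> z" "joins p q r"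
      using bspec[OF R(2)[unfolded covers_def] rz] by auto
    then show ?thesis using P(2) Q(2) kept_Jn[OF Jn.prems] by blast
  qed
  then show ?case using R(1) by blast
qed

text \<open>The read-off when a leaf is put on top: the listed profiles are those of a single vertex
  outside or inside \<open>S\<close>, with its values of \<open>3|S| - 2n\<close>.\<close>

definition bounded_at :: "shape \<Rightarrow> int \<Rightarrow> bool" where
  "bounded_at a z \<longleftrightarrow> (\<forall>Q \<in> set (promises a). \<exists>(p, x) \<in> set [((False,0,0,0),-2), ((True,0,0,0),1)].
     \<exists>(q, y) \<in> set Q. x + y \<le> z \<and> joins p q (fst p, 0, 2, 0))"

text \<open>\<open>Path1\<close>, \<open>Path2\<close>, \<open>Path4\<close> and
  \<open>Path5\<close> are in neither list: below a leaf they yield \<open>P_2\<close>,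
  \<open>P_3\<close>, \<open>P_5\<close> and \<open>P_6\<close>. The second list holds the classes
  that become extremal.\<close>

lemma shapes_bounded:
  "\<forall>a \<in> set [Other, Hub, HubEdge, ForkHub, Missing2, Missing3]. bounded_at a (-3)"
  "\<forall>a \<in> set [Path3, Cherry, Fork, Missing1]. bounded_at a (-2)"
  by code_simp+

lemma bounded_dominating_set:
  assumes "wft (Jn (Lf r) t)" "bounded_at (shape_of t) z"
  shows "\<exists>S \<subseteq> rverts (Jn (Lf r) t). (\<forall>v \<in> rverts (Jn (Lf r) t). dominated (rarcs (Jn (Lf r) t)) S v) \<and>
    3 * int (card S) \<le> 2 * int (card (rverts (Jn (Lf r) t))) + z"
proof -
  let ?t = "Jn (Lf r) t"
  have "wft t" using assms(1) by simp
  then obtain Q where Q: "Q \<in> set (promises (shape_of t))" "\<forall>(q, y) \<in> set Q. kept t q y"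
    using promises_kept by blast
  obtain p x q y where pq: "(p, x) \<in> set [((False,0,0,0),-2), ((True,0,0,0),1)]" "(q, y) \<in> set Q"
      "x + y \<le> z" "joins p q (fst p, 0, 2, 0)"
    using bspec[OF assms(2)[unfolded bounded_at_def] Q(1)] by (smt (verit) case_prodE)
  have "kept (Lf r) p x" using promises_kept[of "Lf r"] pq(1) by auto
  then have "kept ?t (fst p, 0, 2, 0) z"
    using kept_Jn[OF assms(1)] pq Q(2) by blast
  then obtain S where S: "S \<subseteq> rverts ?t" "fits (fst p, 0, 2, 0) ?t S"
      "3 * int (card S) \<le> 2 * int (card (rverts ?t)) + z"
    unfolding kept_def by blast
  have "finite S" using S(1) finite_subset finite_rverts by blast
  then have "\<forall>v \<in> rverts ?t. dominated (rarcs ?t) S v"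
    using fits_final_dominated[OF assms(1) _ S(2)] by blast
  then show ?thesis using S by blast
qed

section \<open>The extremal shapes\<close>

definition vlist :: "'a \<Rightarrow> ('a \<times> 'a \<times> 'a) list \<Rightarrow> 'a list" where
  "vlist v L = v # concat (map (\<lambda>(x, y, z). [x, y, z]) L)"

definition leg_arcs :: "'a \<Rightarrow> 'a \<times> 'a \<times> 'a \<Rightarrow> 'a rel" where
  "leg_arcs v = (\<lambda>(x, y, z). {(v, x), (x, v), (x, y), (y, x), (y, z), (z, y)})"

definition spider_arcs :: "'a \<Rightarrow> ('a \<times> 'a \<times> 'a) list \<Rightarrow> 'a rel" where
  "spider_arcs v L = (\<Union>l \<in> set L. leg_arcs v l)"

definition T_like :: "'a set \<Rightarrow> 'a rel \<Rightarrow> 'a \<Rightarrow> ('a \<times> 'a \<times> 'a) list \<Rightarrow> bool" where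
  "T_like V E v L \<longleftrightarrow> distinct (vlist v L) \<and> V = set (vlist v L) \<and> E = spider_arcs v L"

text \<open>The leg \<open>(u, a, b)\<close> hangs at the vertex \<open>w\<close> of the leg \<open>(w, p, q)\<close> instead of at the centre.\<close>

definition F_like :: "'a set \<Rightarrow> 'a rel \<Rightarrow> 'a \<Rightarrow> bool" where
  "F_like V E v \<longleftrightarrow> (\<exists>w p q u a b L. distinct (vlist v ((w, p, q) # (u, a, b) # L)) \<and>
     V = set (vlist v ((w, p, q) # (u, a, b) # L)) \<and>
     E = spider_arcs v ((w, p, q) # L) \<union> leg_arcs w (u, a, b))"

definition K13_like :: "'a set \<Rightarrow> 'a rel \<Rightarrow> bool" where
  "K13_like V E \<longleftrightarrow> (\<exists>a b c d. distinct [a, b, c, d] \<and> V = {a, b, c, d} \<and>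
     E = {(a, b), (b, a), (a, c), (c, a), (a, d), (d, a)})"

definition T_ast_like :: "'a set \<Rightarrow> 'a rel \<Rightarrow> bool" where
  "T_ast_like V E \<longleftrightarrow> (\<exists>a b c d e f g. distinct [a, b, c, d, e, f, g] \<and> V = {a, b, c, d, e, f, g} \<and>
     E = {(a, b), (b, a), (a, c), (c, a), (a, d), (d, a), (d, e), (e, d), (e, f), (f, e), (f, g), (g, f)})"

fun path_arcs :: "'a list \<Rightarrow> 'a rel" where
  "path_arcs (x # y # xs) = {(x, y), (y, x)} \<union> path_arcs (y # xs)"
| "path_arcs xs = {}"

definition path_like :: "'a set \<Rightarrow> 'a rel \<Rightarrow> nat \<Rightarrow> bool" where
  "path_like V E n \<longleftrightarrow> (\<exists>xs. length xs = n \<and> distinct xs \<and> V = set xs \<and> E = path_arcs xs)"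

lemma F_likeI:
  assumes "distinct (vlist v ((w, p, q) # (u, a, b) # L))" "V = set (vlist v ((w, p, q) # (u, a, b) # L))"
    "E = spider_arcs v ((w, p, q) # L) \<union> leg_arcs w (u, a, b)"
  shows "F_like V E v"
  using assms unfolding F_like_def by blast

lemma T_ast_likeI:
  assumes "distinct [a, b, c, d, e, f, g]" "V = {a, b, c, d, e, f, g}"
    "E = {(a, b), (b, a), (a, c), (c, a), (a, d), (d, a), (d, e), (e, d), (e, f), (f, e), (f, g), (g, f)}"
  shows "T_ast_like V E"
  using assms unfolding T_ast_like_def by blast

lemma path_likeI:
  "length xs = n \<Longrightarrow> distinct xs \<Longrightarrow> V = set xs \<Longrightarrow> E = path_arcs xs \<Longrightarrow> path_like V E n"
  unfolding path_like_def by blast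

lemma vlist_simps [simp]:
  "vlist v [] = [v]"
  "set (vlist v ((x, y, z) # L)) = {x, y, z} \<union> set (vlist v L)"
  "distinct (vlist v ((x, y, z) # L)) \<longleftrightarrow>
     distinct (vlist v L) \<and> distinct [x, y, z] \<and> {x, y, z} \<inter> set (vlist v L) = {}"
  unfolding vlist_def by auto

lemma vlist_center [simp]: "v \<in> set (vlist v L)"
  unfolding vlist_def by simp

lemma spider_arcs_simps [simp]:
  "spider_arcs v [] = {}"
  "spider_arcs v (l # L) = leg_arcs v l \<union> spider_arcs v L"
  unfolding spider_arcs_def by auto

lemma leg_arcs_eq [simp]:
  "leg_arcs v (x, y, z) = {(v, x), (x, v), (x, y), (y, x), (y, z), (z, y)}"
  unfolding leg_arcs_def by simp

section \<open>From classes to the trees in them\<close>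

lemma shape_join_eq_iff:
  "shape_join s t = Path1 \<longleftrightarrow> False"
  "shape_join s t = Path2 \<longleftrightarrow> s = Path1 \<and> t = Path1"
  "shape_join s t = Path3 \<longleftrightarrow> s = Path1 \<and> t = Path2"
  "shape_join s t = Path4 \<longleftrightarrow> s = Path1 \<and> t = Path3"
  "shape_join s t = Path5 \<longleftrightarrow> s = Path1 \<and> t = Path4"
  "shape_join s t = Cherry \<longleftrightarrow> s = Path2 \<and> t = Path1"
  "shape_join s t = Fork \<longleftrightarrow> s = Path3 \<and> t = Path3 \<or> s = Path4 \<and> t = Path2"
  "shape_join s t = Hub \<longleftrightarrow> s \<in> {Path4, Hub} \<and> t = Path3"
  "shape_join s t = HubEdge \<longleftrightarrow> s = Path1 \<and> t = Hub"
  "shape_join s t = ForkHub \<longleftrightarrow> s \<in> {Path1, Path4, Hub} \<and> t = Fork \<or> s = ForkHub \<and> t = Path3"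
  "shape_join s t = Missing1 \<longleftrightarrow> s = Path1 \<and> t \<in> {Path5, HubEdge, Missing2} \<or>
     s = Path2 \<and> t = Path4 \<or> s = Path5 \<and> t = Path1"
  "shape_join s t = Missing2 \<longleftrightarrow> s = Path1 \<and> t \<in> {ForkHub, Missing3} \<or> s = Path2 \<and> t = Path3 \<or>
     s = Path4 \<and> t \<in> {Path1, Path4, Hub} \<or> s \<in> {Path5, HubEdge} \<and> t = Path3"
  "shape_join s t = Missing3 \<longleftrightarrow> s = Path1 \<and> t = Cherry \<or> s = Path2 \<and> t = Path2 \<or>
     s = Path3 \<and> t \<in> {Path1, Path4, Hub} \<or> s \<in> {Path5, HubEdge} \<and> t = Path2"
  by (cases s; cases t; simp)+

lemma shape_Path1: "shape_of t = Path1 \<Longrightarrow> \<exists>a. t = Lf a"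
  by (cases t) (auto simp: shape_join_eq_iff)

lemma shape_Path2: "shape_of t = Path2 \<Longrightarrow> \<exists>a b. t = Jn (Lf a) (Lf b)"
  by (cases t) (auto simp: shape_join_eq_iff dest!: shape_Path1)

lemma shape_Path3: "shape_of t = Path3 \<Longrightarrow> \<exists>a b c. t = Jn (Lf a) (Jn (Lf b) (Lf c))"
  by (cases t) (auto simp: shape_join_eq_iff dest!: shape_Path1 shape_Path2)

lemma shape_Path4: "shape_of t = Path4 \<Longrightarrow> \<exists>a b c d. t = Jn (Lf a) (Jn (Lf b) (Jn (Lf c) (Lf d)))"
  by (cases t) (auto simp: shape_join_eq_iff dest!: shape_Path1 shape_Path3)

lemma shape_Path5:
  "shape_of t = Path5 \<Longrightarrow> \<exists>a b c d e. t = Jn (Lf a) (Jn (Lf b) (Jn (Lf c) (Jn (Lf d) (Lf e))))"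
  by (cases t) (auto simp: shape_join_eq_iff dest!: shape_Path1 shape_Path4)

lemma shape_Cherry: "shape_of t = Cherry \<Longrightarrow> \<exists>a b c. t = Jn (Jn (Lf a) (Lf b)) (Lf c)"
  by (cases t) (auto simp: shape_join_eq_iff dest!: shape_Path1 shape_Path2)

lemma shape_Fork:
  assumes "shape_of t = Fork" "wft t"
  shows "\<exists>p q u a b. distinct [apex t, p, q, u, a, b] \<and> rverts t = {apex t, p, q, u, a, b} \<and>
    rarcs t = leg_arcs (apex t) (u, a, b) \<union> {(apex t, p), (p, apex t), (p, q), (q, p)}"
proof -
  from assms(1) obtain s s' where t: "t = Jn s s'"
    and "shape_of s = Path3 \<and> shape_of s' = Path3 \<or> shape_of s = Path4 \<and> shape_of s' = Path2"
    by (cases t) (auto simp: shape_join_eq_iff)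
  then show ?thesis
  proof (elim disjE conjE)
    assume "shape_of s = Path3" "shape_of s' = Path3"
    then obtain w p q u a b where "s = Jn (Lf w) (Jn (Lf p) (Lf q))" "s' = Jn (Lf u) (Jn (Lf a) (Lf b))"
      by (blast dest: shape_Path3)
    then show ?thesis using assms(2) unfolding t
      by (intro exI[of _ p] exI[of _ q] exI[of _ u] exI[of _ a] exI[of _ b]) auto
  next
    assume "shape_of s = Path4" "shape_of s' = Path2"
    then obtain w p q u a b where "s = Jn (Lf w) (Jn (Lf u) (Jn (Lf a) (Lf b)))" "s' = Jn (Lf p) (Lf q)"
      by (blast dest: shape_Path4 shape_Path2)
    then show ?thesis using assms(2) unfolding t
      by (intro exI[of _ p] exI[of _ q] exI[of _ u] exI[of _ a] exI[of _ b]) auto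
  qed
qed

text \<open>\<open>Path1\<close>, \<open>Path4\<close> and \<open>Hub\<close> are one family: a
  centre with zero, one, or at least two legs. They are separate classes because their vectors
  differ.\<close>

lemma shape_spider:
  assumes "shape_of t \<in> {Path1, Path4, Hub}" "wft t"
  shows "\<exists>L. T_like (rverts t) (rarcs t) (apex t) L"
  using assms
proof (induction t)
  case (Lf a)
  show ?case by (intro exI[of _ "[]"]) (simp add: T_like_def)
next
  case (Jn s t)
  then have "shape_of s \<in> {Path1, Path4, Hub}" "shape_of t = Path3"
    by (auto simp: shape_join_eq_iff)
  then obtain L x y z where L: "T_like (rverts s) (rarcs s) (apex s) L"
    and t: "t = Jn (Lf x) (Jn (Lf y) (Lf z))"
    using Jn shape_Path3[of t] by auto
  show ?case using L Jn.prems unfolding t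
    by (intro exI[of _ "(x, y, z) # L"]) (auto simp: T_like_def)
qed

text \<open>The three classes are again those of zero, one, or at least two legs, now with an edge
  above the centre.\<close>

lemma shape_spider_edge:
  assumes "shape_of t \<in> {Path2, Path5, HubEdge}" "wft t"
  shows "\<exists>a s L. t = Jn (Lf a) s \<and> T_like (rverts s) (rarcs s) (apex s) L"
proof -
  from assms obtain s s' where t: "t = Jn s s'" "shape_of s = Path1" "shape_of s' \<in> {Path1, Path4, Hub}"
    by (cases t) (auto simp: shape_join_eq_iff)
  then show ?thesis using shape_spider[of s'] shape_Path1[of s] assms by auto
qed

text \<open>The root of the \<open>Fork\<close> becomes \<open>w\<close>; its short path completes
  the leg of \<open>w\<close>, and its long path is the displaced leg.\<close>

lemma shape_ForkHub:
  assumes "shape_of t = ForkHub" "wft t"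
  shows "F_like (rverts t) (rarcs t) (apex t)"
  using assms
proof (induction t)
  case (Jn s t)
  then consider (fork) "shape_of s \<in> {Path1, Path4, Hub}" "shape_of t = Fork"
    | (leg) "shape_of s = ForkHub" "shape_of t = Path3"
    by (auto simp: shape_join_eq_iff)
  then show ?case
  proof cases
    case fork
    then obtain L where L: "T_like (rverts s) (rarcs s) (apex s) L"
      using shape_spider[of s] Jn.prems by auto
    obtain p q u a b where F: "distinct [apex t, p, q, u, a, b]" "rverts t = {apex t, p, q, u, a, b}"
      "rarcs t = leg_arcs (apex t) (u, a, b) \<union> {(apex t, p), (p, apex t), (p, q), (q, p)}"
      using shape_Fork[of t] fork Jn.prems by auto
    show ?thesis using L F Jn.prems
      by (intro F_likeI[of _ "apex t" p q u a b L]) (auto simp: T_like_def)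
  next
    case leg
    then obtain w p q u a b L where F: "distinct (vlist (apex s) ((w, p, q) # (u, a, b) # L))"
      "rverts s = set (vlist (apex s) ((w, p, q) # (u, a, b) # L))"
      "rarcs s = spider_arcs (apex s) ((w, p, q) # L) \<union> leg_arcs w (u, a, b)"
      using Jn.IH(1) Jn.prems unfolding F_like_def by (metis wft.simps(2))
    obtain x y z where t: "t = Jn (Lf x) (Jn (Lf y) (Lf z))" using leg shape_Path3 by blast
    show ?thesis using F Jn.prems t
      by (intro F_likeI[of _ w p q u a b "(x, y, z) # L"]) (auto simp: T_like_def)
  qed
qed simp

definition extremal_like :: "'a set \<Rightarrow> 'a rel \<Rightarrow> bool" where
  "extremal_like V E \<longleftrightarrow> (\<exists>v L. L \<noteq> [] \<and> T_like V E v L) \<or> (\<exists>v. F_like V E v) \<or> K13_like V E \<or> T_ast_like V E"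

text \<open>Either \<open>x\<close>, \<open>s\<close>, \<open>r\<close> is the outer part of the
  long branch of \<open>T^*\<close>, or it is the displaced leg of an \<open>F_k\<close> and the
  root of \<open>t\<close> is \<open>w\<close>. The last two cases build the same trees with the
  parts attached in different order.\<close>

lemma shape_Missing3:
  assumes "shape_of t = Missing3" "wft (Jn (Lf r) (Jn (Lf s) (Jn (Lf x) t)))"
  shows "extremal_like (rverts (Jn (Lf r) (Jn (Lf s) (Jn (Lf x) t))))
    (rarcs (Jn (Lf r) (Jn (Lf s) (Jn (Lf x) t))))"
proof -
  let ?t = "Jn (Lf r) (Jn (Lf s) (Jn (Lf x) t))"
  from assms(1) obtain t1 t2 where t: "t = Jn t1 t2" and "shape_join (shape_of t1) (shape_of t2) = Missing3"
    by (cases t) auto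
  then consider "shape_of t1 = Path1" "shape_of t2 = Cherry"
    | "shape_of t1 = Path3" "shape_of t2 \<in> {Path1, Path4, Hub}"
    | "shape_of t1 \<in> {Path2, Path5, HubEdge}" "shape_of t2 = Path2"
    by (auto simp: shape_join_eq_iff)
  then show ?thesis
  proof cases
    case 1
    then obtain a b c d where "t1 = Lf a" "t2 = Jn (Jn (Lf b) (Lf c)) (Lf d)"
      using shape_Path1 shape_Cherry by blast
    then have "T_ast_like (rverts ?t) (rarcs ?t)" using assms(2) unfolding t
      by (intro T_ast_likeI[of b c d a x s r]) auto
    then show ?thesis unfolding extremal_like_def by blast
  next
    case 2
    then obtain w p q where t1: "t1 = Jn (Lf w) (Jn (Lf p) (Lf q))" using shape_Path3 by blast
    obtain L where L: "T_like (rverts t2) (rarcs t2) (apex t2) L"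
      using 2 shape_spider[of t2] assms(2) t by auto
    have "F_like (rverts ?t) (rarcs ?t) (apex t2)" using L assms(2) unfolding t t1
      by (intro F_likeI[of _ w p q x s r L]) (auto simp: T_like_def)
    then show ?thesis unfolding extremal_like_def by blast
  next
    case 3
    then obtain w h L where t1: "t1 = Jn (Lf w) h" and L: "T_like (rverts h) (rarcs h) (apex h) L"
      using shape_spider_edge[of t1] assms(2) t by auto
    obtain p q where t2: "t2 = Jn (Lf p) (Lf q)" using 3 shape_Path2 by blast
    have "F_like (rverts ?t) (rarcs ?t) (apex h)" using L assms(2) unfolding t t1 t2
      by (intro F_likeI[of _ w p q x s r L]) (auto simp: T_like_def)
    then show ?thesis unfolding extremal_like_def by blast
  qed
qed

text \<open>Besides the reduction to \<open>Missing3\<close>, either \<open>r\<close> ends an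
  ordinary leg of \<open>F_k\<close>, or the root of \<open>t\<close> is \<open>w\<close> and
  \<open>s\<close>, \<open>r\<close> complete its leg.\<close>

lemma shape_Missing2:
  assumes "shape_of t = Missing2" "wft (Jn (Lf r) (Jn (Lf s) t))"
  shows "extremal_like (rverts (Jn (Lf r) (Jn (Lf s) t))) (rarcs (Jn (Lf r) (Jn (Lf s) t)))"
proof -
  let ?t = "Jn (Lf r) (Jn (Lf s) t)"
  from assms(1) obtain t1 t2 where t: "t = Jn t1 t2" and "shape_join (shape_of t1) (shape_of t2) = Missing2"
    by (cases t) auto
  then consider "shape_of t1 = Path1" "shape_of t2 = Missing3" | "shape_of t1 = Path1" "shape_of t2 = ForkHub"
    | "shape_of t1 = Path4" "shape_of t2 \<in> {Path1, Path4, Hub}"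
    | "shape_of t1 \<in> {Path2, Path5, HubEdge}" "shape_of t2 = Path3"
    by (auto simp: shape_join_eq_iff)
  then show ?thesis
  proof cases
    case 1
    then obtain x where "t1 = Lf x" using shape_Path1 by blast
    then show ?thesis using shape_Missing3[of t2 r s x] 1 assms(2) unfolding t by simp
  next
    case 2
    then obtain x where t1: "t1 = Lf x" using shape_Path1 by blast
    have "F_like (rverts t2) (rarcs t2) (apex t2)" using shape_ForkHub[of t2] 2 assms(2) t by auto
    then obtain w p q u a b L where F: "distinct (vlist (apex t2) ((w, p, q) # (u, a, b) # L))"
      "rverts t2 = set (vlist (apex t2) ((w, p, q) # (u, a, b) # L))"
      "rarcs t2 = spider_arcs (apex t2) ((w, p, q) # L) \<union> leg_arcs w (u, a, b)"
      unfolding F_like_def by blast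
    have "F_like (rverts ?t) (rarcs ?t) (apex t2)" using F assms(2) unfolding t t1
      by (intro F_likeI[of _ w p q u a b "(x, s, r) # L"]) (auto simp: T_like_def)
    then show ?thesis unfolding extremal_like_def by blast
  next
    case 3
    then obtain w u a b where t1: "t1 = Jn (Lf w) (Jn (Lf u) (Jn (Lf a) (Lf b)))" using shape_Path4 by blast
    obtain L where L: "T_like (rverts t2) (rarcs t2) (apex t2) L"
      using 3 shape_spider[of t2] assms(2) t by auto
    have "F_like (rverts ?t) (rarcs ?t) (apex t2)" using L assms(2) unfolding t t1
      by (intro F_likeI[of _ w s r u a b L]) (auto simp: T_like_def)
    then show ?thesis unfolding extremal_like_def by blast
  next
    case 4
    then obtain w h L where t1: "t1 = Jn (Lf w) h" and L: "T_like (rverts h) (rarcs h) (apex h) L"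
      using shape_spider_edge[of t1] assms(2) t by auto
    obtain u a b where t2: "t2 = Jn (Lf u) (Jn (Lf a) (Lf b))" using 4 shape_Path3 by blast
    have "F_like (rverts ?t) (rarcs ?t) (apex h)" using L assms(2) unfolding t t1 t2
      by (intro F_likeI[of _ w s r u a b L]) (auto simp: T_like_def)
    then show ?thesis unfolding extremal_like_def by blast
  qed
qed

text \<open>Besides the reduction to \<open>Missing2\<close>, \<open>r\<close> is the end of a leg
  of \<open>T_k\<close> or one of the two leaves at the centre of \<open>T^*\<close>.\<close>

lemma shape_Missing1:
  assumes "shape_of t = Missing1" "wft (Jn (Lf r) t)"
  shows "extremal_like (rverts (Jn (Lf r) t)) (rarcs (Jn (Lf r) t))"
proof -
  let ?t = "Jn (Lf r) t"
  from assms(1) obtain t1 t2 where t: "t = Jn t1 t2" and "shape_join (shape_of t1) (shape_of t2) = Missing1"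
    by (cases t) auto
  then consider "shape_of t1 = Path1" "shape_of t2 = Missing2"
    | "shape_of t1 = Path1" "shape_of t2 \<in> {Path2, Path5, HubEdge}"
    | "shape_of t1 = Path2" "shape_of t2 = Path4" | "shape_of t1 = Path5" "shape_of t2 = Path1"
    by (auto simp: shape_join_eq_iff)
  then show ?thesis
  proof cases
    case 1
    then obtain x where "t1 = Lf x" using shape_Path1 by blast
    then show ?thesis using shape_Missing2[of t2 r x] 1 assms(2) unfolding t by simp
  next
    case 2
    then obtain y where t1: "t1 = Lf y" using shape_Path1 by blast
    obtain x h L where t2: "t2 = Jn (Lf x) h" and L: "T_like (rverts h) (rarcs h) (apex h) L"
      using 2 shape_spider_edge[of t2] assms(2) t by auto
    have "T_like (rverts ?t) (rarcs ?t) (apex h) ((x, y, r) # L)"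
      using L assms(2) unfolding t t1 t2 by (auto simp: T_like_def)
    then show ?thesis unfolding extremal_like_def by blast
  next
    case 3
    then obtain a b c d e f where "t1 = Jn (Lf a) (Lf b)" "t2 = Jn (Lf c) (Jn (Lf d) (Jn (Lf e) (Lf f)))"
      using shape_Path2[of t1] shape_Path4[of t2] by blast
    then have "T_ast_like (rverts ?t) (rarcs ?t)" using assms(2) unfolding t
      by (intro T_ast_likeI[of a b r c d e f]) auto
    then show ?thesis unfolding extremal_like_def by blast
  next
    case 4
    then obtain a b c d e f where "t2 = Lf b" "t1 = Jn (Lf a) (Jn (Lf c) (Jn (Lf d) (Jn (Lf e) (Lf f))))"
      using shape_Path1[of t2] shape_Path5[of t1] by blast
    then have "T_ast_like (rverts ?t) (rarcs ?t)" using assms(2) unfolding t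
      by (intro T_ast_likeI[of a b r c d e f]) auto
    then show ?thesis unfolding extremal_like_def by blast
  qed
qed

text \<open>\<open>Path3\<close> and \<open>Cherry\<close> give \<open>T_1\<close> and
  \<open>K_{1,3}\<close>. \<open>Fork\<close> gives \<open>F_2\<close>, whose centre has lost one of
  its two neighbours and is therefore the leaf \<open>r\<close>.\<close>

lemma shape_extremal:
  assumes "shape_of t \<in> {Path3, Cherry, Fork, Missing1}" "wft (Jn (Lf r) t)"
  shows "extremal_like (rverts (Jn (Lf r) t)) (rarcs (Jn (Lf r) t))"
proof -
  let ?t = "Jn (Lf r) t"
  from assms(1) consider "shape_of t = Path3" | "shape_of t = Cherry" | "shape_of t = Fork"
    | "shape_of t = Missing1" by auto
  then show ?thesis
  proof cases
    case 1
    then obtain a b c where "t = Jn (Lf a) (Jn (Lf b) (Lf c))" using shape_Path3 by blast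
    then have "T_like (rverts ?t) (rarcs ?t) r [(a, b, c)]"
      using assms(2) by (auto simp: T_like_def)
    then show ?thesis unfolding extremal_like_def by blast
  next
    case 2
    then obtain a b c where "t = Jn (Jn (Lf a) (Lf b)) (Lf c)" using shape_Cherry by blast
    then have "K13_like (rverts ?t) (rarcs ?t)"
      using assms(2) unfolding K13_like_def
      by (intro exI[of _ a] exI[of _ b] exI[of _ c] exI[of _ r]) auto
    then show ?thesis unfolding extremal_like_def by blast
  next
    case 3
    then have "shape_of ?t = ForkHub" by simp
    from shape_ForkHub[OF this assms(2)] show ?thesis unfolding extremal_like_def by blast
  next
    case 4
    then show ?thesis using shape_Missing1[OF 4 assms(2)] by simp
  qed
qed

lemma shape_path:
  assumes "shape_of t \<in> {Path1, Path2, Path4, Path5}" "wft (Jn (Lf r) t)"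
  shows "card (rverts (Jn (Lf r) t)) \<le> 3 \<or>
    path_like (rverts (Jn (Lf r) t)) (rarcs (Jn (Lf r) t)) 5 \<or>
    path_like (rverts (Jn (Lf r) t)) (rarcs (Jn (Lf r) t)) 6"
proof -
  let ?t = "Jn (Lf r) t"
  from assms(1) consider "shape_of t = Path1" | "shape_of t = Path2" | "shape_of t = Path4"
    | "shape_of t = Path5" by auto
  then show ?thesis
  proof cases
    case 1
    then obtain a where "t = Lf a" using shape_Path1 by blast
    then show ?thesis using card_length[of "[r, a]"] by (simp add: insert_commute)
  next
    case 2
    then obtain a b where "t = Jn (Lf a) (Lf b)" using shape_Path2 by blast
    then show ?thesis using card_length[of "[r, a, b]"] by (simp add: insert_commute)
  next
    case 3
    then obtain a b c d where "t = Jn (Lf a) (Jn (Lf b) (Jn (Lf c) (Lf d)))" using shape_Path4 by blast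
    then have "path_like (rverts ?t) (rarcs ?t) 5" using assms(2)
      by (intro path_likeI[of "[r, a, b, c, d]"]) auto
    then show ?thesis by blast
  next
    case 4
    then obtain a b c d e where "t = Jn (Lf a) (Jn (Lf b) (Jn (Lf c) (Jn (Lf d) (Lf e))))"
      using shape_Path5 by blast
    then have "path_like (rverts ?t) (rarcs ?t) 6" using assms(2)
      by (intro path_likeI[of "[r, a, b, c, d, e]"]) auto
    then show ?thesis by blast
  qed
qed

section \<open>Tree graphs as rooted trees\<close>

primrec attach :: "'a \<Rightarrow> 'a \<Rightarrow> 'a rtree \<Rightarrow> 'a rtree" where
  "attach p l (Lf a) = Jn (Lf a) (Lf l)"
| "attach p l (Jn s t) = (if p \<in> rverts s then Jn (attach p l s) t else Jn s (attach p l t))"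

lemma attach:
  assumes "wft t" "p \<in> rverts t" "l \<notin> rverts t"
  shows "wft (attach p l t) \<and> apex (attach p l t) = apex t \<and> rverts (attach p l t) = insert l (rverts t) \<and>
    rarcs (attach p l t) = rarcs t \<union> {(p, l), (l, p)}"
  using assms
proof (induction t)
  case (Jn s t)
  show ?case
  proof (cases "p \<in> rverts s")
    case True
    then show ?thesis using Jn.IH(1) Jn.prems by auto
  next
    case False
    then show ?thesis using Jn.IH(2) Jn.prems by auto
  qed
qed auto

lemma rtrancl_leaves_set:
  assumes "(u, v) \<in> E\<^sup>*" "u \<in> A" "v \<notin> A"
  shows "\<exists>p \<in> A. \<exists>l. l \<notin> A \<and> (p, l) \<in> E"
  using assms by (induction rule: rtrancl_induct) auto

lemma rtrancl_rarcs:
  assumes "u \<in> rverts t" "v \<in> rverts t"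
  shows "(u, v) \<in> (rarcs t)\<^sup>*"
proof -
  have *: "(apex t, v) \<in> (rarcs t)\<^sup>*" if "v \<in> rverts t" for v
    using that
  proof (induction t)
    case (Jn s t)
    show ?case
    proof (cases "v \<in> rverts s")
      case True
      then have "(apex s, v) \<in> (rarcs s)\<^sup>*" using Jn by auto
      then show ?thesis using rtrancl_mono[of "rarcs s" "rarcs (Jn s t)"] by auto
    next
      case False
      then have "(apex t, v) \<in> (rarcs t)\<^sup>*" using Jn by auto
      then have "(apex t, v) \<in> (rarcs (Jn s t))\<^sup>*"
        using rtrancl_mono[of "rarcs t" "rarcs (Jn s t)"] by auto
      then show ?thesis by (auto intro: converse_rtrancl_into_rtrancl)
    qed
  qed simp
  have "sym (rarcs t)" by (intro symI) (rule sym_rarcs)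
  then have "(u, apex t) \<in> (rarcs t)\<^sup>*" using *[OF assms(1)] by (metis sym_rtrancl symD)
  then show ?thesis using *[OF assms(2)] by (rule rtrancl_trans)
qed

lemma tree_graph_connectedD:
  assumes "tree_graph T" "u \<in> pverts T" "v \<in> pverts T"
  shows "(u, v) \<in> (parcs T)\<^sup>*"
proof -
  interpret pair_graph T using assms(1) unfolding tree_graph_def by blast
  have "Digraph_Component.connected (with_proj T)" using assms(1) unfolding tree_graph_def by blast
  then have "u \<rightarrow>\<^sup>*\<^bsub>mk_symmetric (with_proj T)\<^esub> v"
    using assms(2,3) unfolding Digraph_Component.connected_def strongly_connected_def by simp
  then have "u \<rightarrow>\<^sup>*\<^bsub>with_proj T\<^esub> v"
    using reachable_mk_symmetric_eq by auto
  then show ?thesis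
    unfolding reachable_def by (auto dest: rtrancl_on_rtranclI)
qed

lemma tree_graph_no_cycle:
  assumes "tree_graph T" "u \<in> pverts T" "set p \<subseteq> parcs T" "pcas u p u"
    "distinct (tl (pawalk_verts u p))"
  shows "length p < 3"
proof (rule ccontr)
  assume "\<not> length p < 3"
  then have "pre_digraph.cycle (with_proj T) p \<and> length p \<ge> 3"
    using assms unfolding pre_digraph.cycle_def pre_digraph.awalk_def
    by (auto simp: cas_with_proj_eq awalk_verts_with_proj_eq)
  then show False using assms(1) unfolding tree_graph_def by blast
qed

lemma pcas_append: "pcas u (p @ q) v \<longleftrightarrow> (\<exists>w. pcas u p w \<and> pcas w q v)"
  by (induction p arbitrary: u) auto

lemma pawalk_verts_snoc: "pcas u p w \<Longrightarrow> pawalk_verts u (p @ [(w, x)]) = pawalk_verts u p @ [x]"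
  by (induction p arbitrary: u) auto

lemma pawalk_verts_eq_Cons: "pcas u p w \<Longrightarrow> \<exists>vs. pawalk_verts u p = u # vs"
  by (cases p) auto

text \<open>A further arc would close the tree path between its ends to a cycle. That path has at
  least two arcs, as the closing arc is not in the spanning tree, so the cycle has length at least
  3.\<close>

lemma tree_graph_spanning_rarcs:
  assumes T: "tree_graph T" and "wft t" and V: "rverts t = pverts T" and E: "rarcs t \<subseteq> parcs T"
  shows "rarcs t = parcs T"
proof (rule ccontr)
  assume "rarcs t \<noteq> parcs T"
  then obtain u v where uv: "(u, v) \<in> parcs T" "(u, v) \<notin> rarcs t" using E by auto
  interpret T: pair_graph T using T unfolding tree_graph_def by blast
  have in_V: "u \<in> rverts t" "v \<in> rverts t" using uv(1) T.in_arcsD1 T.in_arcsD2 V by auto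
  let ?G = "\<lparr>pverts = rverts t, parcs = rarcs t\<rparr>"
  interpret G: pair_wf_digraph ?G by unfold_locales (auto dest: rarcs_in_rverts)
  have "(u, v) \<in> rtrancl_on (rverts t) (rarcs t)"
    using rtrancl_consistent_rtrancl_on[OF rtrancl_rarcs[OF in_V]] in_V rarcs_in_rverts[of _ _ t] by auto
  then have "u \<rightarrow>\<^sup>*\<^bsub>with_proj ?G\<^esub> v" unfolding reachable_def by simp
  then obtain p where "G.apath u p v" using G.reachable_apath by blast
  then have p: "set p \<subseteq> rarcs t" "pcas u p v" "distinct (pawalk_verts u p)"
    unfolding G.apath_def G.awalk_def by auto
  have "u \<noteq> v" using uv(1) T.no_loops' by auto
  then have "p \<noteq> []" "\<And>e. p \<noteq> [e]" using p uv(2) by (auto simp: surjective_pairing)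
  then have len: "length p \<ge> 2" by (cases p; cases "tl p") auto
  obtain vs where vs: "pawalk_verts u p = u # vs" using pawalk_verts_eq_Cons[OF p(2)] by blast
  have "distinct (tl (pawalk_verts u (p @ [(v, u)])))"
    using pawalk_verts_snoc[OF p(2), of u] vs p(3) by simp
  moreover have "pcas u (p @ [(v, u)]) u" using p(2) unfolding pcas_append by (intro exI[of _ v] conjI) simp_all
  moreover have "set (p @ [(v, u)]) \<subseteq> parcs T" using p(1) E uv(1) T.arcs_symmetric by auto
  ultimately have "length (p @ [(v, u)]) < 3"
    using tree_graph_no_cycle[OF T, of u] in_V V by blast
  then show False using len by simp
qed

text \<open>Growth from \<open>Lf r\<close> along arcs that leave the current vertex set reaches all
  vertices; acyclicity then leaves no further arcs.\<close>

lemma tree_graph_rtree: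
  assumes T: "tree_graph T" and r: "r \<in> pverts T"
  shows "\<exists>t. wft t \<and> apex t = r \<and> rverts t = pverts T \<and> rarcs t = parcs T"
proof -
  interpret T: pair_graph T using T unfolding tree_graph_def by blast
  have fin: "finite (pverts T)" by simp
  have "\<exists>t. wft t \<and> apex t = r \<and> rverts t \<subseteq> pverts T \<and> rarcs t \<subseteq> parcs T \<and> card (rverts t) = Suc k"
    if "Suc k \<le> card (pverts T)" for k
    using that
  proof (induction k)
    case 0
    show ?case using r by (intro exI[of _ "Lf r"]) simp
  next
    case (Suc k)
    then obtain t where t: "wft t" "apex t = r" "rverts t \<subseteq> pverts T" "rarcs t \<subseteq> parcs T"
      "card (rverts t) = Suc k" by auto
    then obtain v where v: "v \<in> pverts T" "v \<notin> rverts t"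
      using Suc.prems by (metis Suc_n_not_le_n subsetI subset_antisym)
    obtain p l where pl: "p \<in> rverts t" "l \<notin> rverts t" "(p, l) \<in> parcs T"
      using rtrancl_leaves_set[OF tree_graph_connectedD[OF T r v(1)], of "rverts t"] v(2) t(2)
        apex_in_rverts[of t] by blast
    have a: "wft (attach p l t) \<and> apex (attach p l t) = apex t \<and> rverts (attach p l t) = insert l (rverts t) \<and>
        rarcs (attach p l t) = rarcs t \<union> {(p, l), (l, p)}"
      using attach[OF t(1) pl(1,2)] .
    show ?case using a t pl T.in_arcsD2[OF pl(3)] T.arcs_symmetric[OF pl(3)]
      by (intro exI[of _ "attach p l t"]) auto
  qed
  moreover have "card (pverts T) > 0" using r fin by (auto simp: card_gt_0_iff)
  ultimately obtain t where t: "wft t" "apex t = r" "rverts t \<subseteq> pverts T" "rarcs t \<subseteq> parcs T"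
    "card (rverts t) = card (pverts T)"
    by (metis Suc_pred order_refl)
  then have "rverts t = pverts T" using fin by (simp add: card_subset_eq)
  then show ?thesis using t tree_graph_spanning_rarcs[OF T] by blast
qed

text \<open>Descend into the last attached subtree until it is a single vertex.\<close>

lemma rtree_has_leaf:
  assumes "wft (Jn s t)"
  shows "\<exists>l \<in> rverts (Jn s t). l \<noteq> apex s \<and> (\<exists>p. \<forall>x. (l, x) \<in> rarcs (Jn s t) \<longleftrightarrow> x = p)"
  using assms
proof (induction t arbitrary: s)
  case (Lf b)
  then have "apex s \<noteq> b" "\<And>x. (b, x) \<notin> rarcs s"
    using apex_in_rverts[of s] rarcs_in_rverts[of b _ s] by auto
  then show ?case by (intro bexI[of _ b]) auto
next
  case (Jn t1 t2)
  then obtain l p where l: "l \<in> rverts (Jn t1 t2)" "l \<noteq> apex t1"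
    "\<And>x. (l, x) \<in> rarcs (Jn t1 t2) \<longleftrightarrow> x = p"
    by (metis wft.simps(2))
  then have "l \<notin> rverts s" using Jn.prems by auto
  then have "l \<noteq> apex s" "\<And>x. (l, x) \<notin> rarcs s"
    using apex_in_rverts[of s] rarcs_in_rverts[of l _ s] by auto
  then show ?case using l by (intro bexI[of _ l]) auto
qed

lemma tree_graph_leaf_rtree:
  assumes T: "tree_graph T" and n: "card (pverts T) \<ge> 2"
  shows "\<exists>r t. wft (Jn (Lf r) t) \<and> rverts (Jn (Lf r) t) = pverts T \<and> rarcs (Jn (Lf r) t) = parcs T"
proof -
  obtain r where "r \<in> pverts T" using n by (metis card.empty ex_in_conv not_numeral_le_zero)
  then obtain t where t: "wft t" "rverts t = pverts T" "rarcs t = parcs T"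
    using tree_graph_rtree[OF T] by blast
  then have "card (rverts t) \<ge> 2" using n by simp
  then obtain s s' where "t = Jn s s'" by (cases t) auto
  then obtain l p where l: "l \<in> pverts T" "\<And>x. (l, x) \<in> parcs T \<longleftrightarrow> x = p"
    using rtree_has_leaf[of s s'] t by metis
  \<comment> \<open>The tree is rebuilt with the leaf as root; having one neighbour, that root has
    one child.\<close>
  obtain t' where t': "wft t'" "apex t' = l" "rverts t' = pverts T" "rarcs t' = parcs T"
    using tree_graph_rtree[OF T l(1)] by blast
  then have "card (rverts t') \<ge> 2" using n by simp
  then obtain u u' where u: "t' = Jn u u'" by (cases t') auto
  have "u = Lf l"
  proof (cases u)
    case (Jn u1 u2)
    then have "(l, apex u2) \<in> parcs T" "(l, apex u') \<in> parcs T" using t' u by auto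
    then have "apex u2 = apex u'" using l(2) by simp
    then show ?thesis using t'(1) u Jn apex_in_rverts[of u2] apex_in_rverts[of u'] by auto
  qed (use t' u in auto)
  then show ?thesis using t' u by blast
qed

section \<open>Distance two in trees\<close>

lemma tree_graph_no_triangle:
  assumes T: "tree_graph T" and "(a, b) \<in> parcs T" "(b, c) \<in> parcs T" "(c, a) \<in> parcs T"
  shows False
proof -
  interpret T: pair_graph T using T unfolding tree_graph_def by blast
  have "length [(a, b), (b, c), (c, a)] < 3"
    using assms T.in_arcsD1[of a b] T.no_loops'[of a b] T.no_loops'[of b c] T.no_loops'[of c a]
    by (intro tree_graph_no_cycle[OF T, of a]) auto
  then show False by simp
qed

text \<open>A vertex reached in two steps could also be a neighbour; the absence of triangles
  excludes this, so distance 2 becomes a condition on arcs alone.\<close>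

lemma graph_dist_eq_2_iff:
  assumes T: "tree_graph T" and v: "v \<in> pverts T"
  shows "graph_dist T v s = 2 \<longleftrightarrow> s \<in> two_steps (parcs T) v"
proof -
  interpret T: pair_graph T using T unfolding tree_graph_def by blast
  have cost: "T.awalk_cost (\<lambda>_. 1) p = length p" for p
    by (induction p) auto
  have walk: "graph_dist T v s \<le> ereal (length p)" if "T.awalk v p s" for p
    using T.min_cost_le_walk_cost[OF that, of "\<lambda>_. 1"] unfolding graph_dist_def cost by simp
  show ?thesis
  proof
    assume "s \<in> two_steps (parcs T) v"
    then obtain w where w: "s \<noteq> v" "(v, w) \<in> parcs T" "(w, s) \<in> parcs T" unfolding two_steps_def by auto
    have "T.awalk v [(v, w), (w, s)] s" using w v unfolding T.awalk_def by auto
    from walk[OF this] have "graph_dist T v s \<le> 2" by simp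
    moreover have "2 \<le> T.awalk_cost (\<lambda>_. 1) p" if "T.awalk v p s" for p
    proof -
      have "p \<noteq> []" using that w(1) unfolding T.awalk_def by auto
      moreover have "p \<noteq> [e]" for e
      proof
        assume "p = [e]"
        then have "(v, s) \<in> parcs T" using that unfolding T.awalk_def by (cases e) auto
        then show False using w tree_graph_no_triangle[OF T, of v w s] T.arcs_symmetric by blast
      qed
      ultimately have "length p \<ge> 2" by (cases p; cases "tl p") auto
      then show ?thesis unfolding cost by simp
    qed
    then have "2 \<le> graph_dist T v s"
      unfolding graph_dist_def T.\<mu>_def by (intro INF_greatest) simp
    ultimately show "graph_dist T v s = 2" by simp
  next
    assume d: "graph_dist T v s = 2"
    then have "T.\<mu> (\<lambda>_. 1) v s < 3" unfolding graph_dist_def by simp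
    then obtain p where p: "T.awalk v p s" "length p < 3"
      unfolding T.\<mu>_def INF_less_iff cost by auto
    have "\<not> T.awalk v [] s" "\<And>e. \<not> T.awalk v [e] s"
      using walk[of "[]"] walk[of "[e]" for e] d by auto
    then obtain e f where "p = [e, f]" using p by (cases p; cases "tl p") auto
    moreover have "s \<noteq> v" using \<open>\<not> T.awalk v [] s\<close> v unfolding T.awalk_def by auto
    ultimately show "s \<in> two_steps (parcs T) v"
      using p(1) unfolding two_steps_def T.awalk_def by (cases e; cases f) auto
  qed
qed

lemma disj_total_dominating_iff:
  assumes T: "tree_graph T"
  shows "disj_total_dominating T S \<longleftrightarrow> S \<subseteq> pverts T \<and> (\<forall>v \<in> pverts T. dominated (parcs T) S v)"
proof -
  have "{s \<in> S. graph_dist T v s = 2} = S \<inter> two_steps (parcs T) v" if "v \<in> pverts T" for v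
    using graph_dist_eq_2_iff[OF T that] by auto
  then show ?thesis unfolding disj_total_dominating_def dominated_def by simp
qed

section \<open>Isomorphisms\<close>

text \<open>An isomorphism also has maps for arcs, tails and heads. Both graphs use
  \<open>fst\<close> and \<open>snd\<close> as tail and head, which forces the arc map to be induced
  by the vertex map.\<close>

lemma graph_isoD:
  assumes "G \<simeq>\<^sub>g H"
  shows "\<exists>f. inj_on f (pverts G) \<and> pverts H = f ` pverts G \<and> parcs H = map_prod f f ` parcs G"
proof -
  obtain h where h: "pre_digraph.digraph_isomorphism (with_proj G) h" "with_proj H = app_iso h (with_proj G)"
    using assms unfolding digraph_iso_def by blast
  let ?f = "iso_verts h"
  have t: "iso_tail h = fst" "iso_head h = snd"
    using h(2) arg_cong[of _ _ tail] arg_cong[of _ _ head] unfolding app_iso_def with_proj_def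
    by (auto dest: arg_cong[of _ _ tail] arg_cong[of _ _ head])
  have "iso_arcs h a = map_prod ?f ?f a" if "a \<in> parcs G" for a
    using h(1) that unfolding pre_digraph.digraph_isomorphism_def t
    by (cases a) (auto intro: prod_eqI)
  then have "iso_arcs h ` parcs G = map_prod ?f ?f ` parcs G" by (rule image_cong[OF refl])
  moreover have "pverts H = ?f ` pverts G" "parcs H = iso_arcs h ` parcs G"
    using h(2) unfolding app_iso_def with_proj_def by auto
  moreover have "inj_on ?f (pverts G)"
    using h(1) unfolding pre_digraph.digraph_isomorphism_def by simp
  ultimately show ?thesis by (intro exI[of _ ?f]) simp
qed

lemma graph_isoI:
  assumes "inj_on g (pverts H)" "parcs H \<subseteq> pverts H \<times> pverts H"
    and "pverts G = g ` pverts H" "parcs G = map_prod g g ` parcs H"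
  shows "G \<simeq>\<^sub>g H"
proof -
  let ?h = "\<lparr>iso_verts = g, iso_arcs = map_prod g g, iso_head = snd, iso_tail = fst\<rparr>"
  have wf: "wf_digraph (with_proj H)" using assms(2) by unfold_locales auto
  have "inj_on (map_prod g g) (parcs H)"
    using map_prod_inj_on[OF assms(1) assms(1)] assms(2) by (rule inj_on_subset)
  then have "pre_digraph.digraph_isomorphism (with_proj H) ?h"
    using wf assms(1) unfolding pre_digraph.digraph_isomorphism_def by simp
  moreover have "with_proj G = app_iso ?h (with_proj H)"
    using assms(3,4) unfolding app_iso_def with_proj_def by simp
  ultimately have "digraph_iso (with_proj H) (with_proj G)" unfolding digraph_iso_def by blast
  then show ?thesis using wf digraph_iso_swap by blast
qed

lemma dominated_image:
  assumes "inj_on f V" "E \<subseteq> V \<times> V" "S \<subseteq> V" "finite S" "v \<in> V" "dominated E S v"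
  shows "dominated (map_prod f f ` E) (f ` S) (f v)"
proof -
  consider s where "s \<in> S" "(v, s) \<in> E" | "2 \<le> card (S \<inter> two_steps E v)"
    using assms(6) unfolding dominated_def by blast
  then show ?thesis
  proof cases
    case 1
    then have "(f v, f s) \<in> map_prod f f ` E" by (metis map_prod_imageI)
    then show ?thesis using 1 unfolding dominated_def by blast
  next
    case 2
    have "f ` (S \<inter> two_steps E v) \<subseteq> f ` S \<inter> two_steps (map_prod f f ` E) (f v)"
    proof
      fix y assume "y \<in> f ` (S \<inter> two_steps E v)"
      then obtain s w where s: "y = f s" "s \<in> S" "s \<noteq> v" "(v, w) \<in> E" "(w, s) \<in> E"
        unfolding two_steps_def by blast
      have "f s \<noteq> f v" using s assms(1,3,5) by (meson inj_onD subsetD)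
      moreover have "(f v, f w) \<in> map_prod f f ` E" "(f w, f s) \<in> map_prod f f ` E"
        using s by (metis map_prod_imageI)+
      ultimately have "f s \<in> two_steps (map_prod f f ` E) (f v)"
        unfolding two_steps_def by (intro CollectI conjI exI[of _ "f w"])
      then show "y \<in> f ` S \<inter> two_steps (map_prod f f ` E) (f v)" using s by simp
    qed
    then have "card (f ` (S \<inter> two_steps E v)) \<le> card (f ` S \<inter> two_steps (map_prod f f ` E) (f v))"
      using assms(4) by (intro card_mono) auto
    moreover have "card (f ` (S \<inter> two_steps E v)) = card (S \<inter> two_steps E v)"
      using assms(1,3) by (intro card_image) (meson inf.coboundedI1 inj_on_subset)
    ultimately show ?thesis using 2 unfolding dominated_def by simp
  qed
qed

subsection \<open>Recognising the extremal graphs\<close>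

lemma T_like_numbering:
  assumes "T_like V E v L"
  defines "k \<equiv> length L"
  obtains g where "inj_on g {0..3 * k}" "V = g ` {0..3 * k}" "E = map_prod g g ` parcs (T_graph k)"
    "g 0 = v" "\<And>i. i < k \<Longrightarrow> g (k + Suc i) = fst (L ! i)"
proof -
  \<comment> \<open>The numbering of \<open>T_graph\<close>: leg \<open>i\<close>, counted from 1,
    runs through \<open>k + i\<close>, \<open>2 * k + i\<close>, \<open>i\<close> from the centre
    outwards.\<close>
  define g where "g j = (if j = 0 then v else if j \<le> k then snd (snd (L ! (j - 1)))
     else if j \<le> 2 * k then fst (L ! (j - k - 1)) else fst (snd (L ! (j - 2 * k - 1))))" for j
  have g0: "g 0 = v" by (simp add: g_def)
  have g: "g i = snd (snd (L ! (i - 1)))" "g (k + i) = fst (L ! (i - 1))"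
    "g (2 * k + i) = fst (snd (L ! (i - 1)))" if "i \<in> {1..k}" for i
    using that by (auto simp: g_def)
  have setL: "set L = (\<lambda>i. L ! (i - 1)) ` {1..k}"
  proof (intro equalityI subsetI)
    fix l assume "l \<in> set L"
    then obtain i where "i < k" "l = L ! i" unfolding k_def by (metis in_set_conv_nth)
    then show "l \<in> (\<lambda>i. L ! (i - 1)) ` {1..k}" by (intro image_eqI[of _ _ "Suc i"]) simp_all
  qed (auto simp: k_def)
  have dom: "{0..3 * k} = insert 0 (\<Union>i \<in> {1..k}. {k + i, 2 * k + i, i})"
  proof
    show "{0..3 * k} \<subseteq> insert 0 (\<Union>i \<in> {1..k}. {k + i, 2 * k + i, i})"
    proof
      fix j assume "j \<in> {0..3 * k}"
      then consider "j = 0" | "j \<in> {1..k}" | "j - k \<in> {1..k}" "j = k + (j - k)"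
        | "j - 2 * k \<in> {1..k}" "j = 2 * k + (j - 2 * k)"
        by (simp, linarith)
      then show "j \<in> insert 0 (\<Union>i \<in> {1..k}. {k + i, 2 * k + i, i})"
        by cases blast+
    qed
  qed auto
  have "set (vlist v L) = insert v (\<Union>l \<in> set L. {fst l, fst (snd l), snd (snd l)})"
    unfolding vlist_def by (force simp: split_beta)
  then have V: "V = g ` {0..3 * k}"
    using assms(1) g unfolding dom setL T_like_def by (simp add: g0 image_UN)
  \<comment> \<open>Injectivity comes from counting: \<open>V\<close> is the image of
    \<open>3 * k + 1\<close> numbers and has \<open>3 * k + 1\<close> elements.\<close>
  have "card V = length (vlist v L)"
    using assms(1) distinct_card unfolding T_like_def by blast
  also have "\<dots> = 3 * k + 1"
    unfolding k_def vlist_def by (induction L) auto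
  finally have "card (g ` {0..3 * k}) = card {0..3 * k}" using V by simp
  then have inj: "inj_on g {0..3 * k}" by (intro eq_card_imp_inj_on) auto
  have "E = (\<Union>l \<in> set L. leg_arcs v l)"
    using assms(1) unfolding T_like_def spider_arcs_def by simp
  also have "\<dots> = map_prod g g ` parcs (T_graph k)"
    unfolding T_graph_explicit setL image_UN leg_arcs_def using g by (simp add: g0 split_beta)
  finally show thesis using that[OF inj V] g0 g(2)[of "Suc i" for i] by simp
qed

lemma T_graph_arcs_in_verts: "parcs (T_graph k) \<subseteq> pverts (T_graph k) \<times> pverts (T_graph k)"
  unfolding T_graph_explicit by auto

lemma T_like_iso:
  assumes "T_like (pverts T) (parcs T) v L"
  shows "T \<simeq>\<^sub>g T_graph (length L)"
proof -
  obtain g where "inj_on g {0..3 * length L}" "pverts T = g ` {0..3 * length L}"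
      "parcs T = map_prod g g ` parcs (T_graph (length L))"
    using T_like_numbering[OF assms] by metis
  then show ?thesis using T_graph_arcs_in_verts by (intro graph_isoI[of g]) (auto simp: T_graph_explicit(1))
qed

lemma spider_arcs_in_vlist: "spider_arcs v L \<subseteq> set (vlist v L) \<times> set (vlist v L)"
  unfolding spider_arcs_def leg_arcs_def vlist_def by fastforce

lemma F_like_iso:
  assumes "F_like (pverts T) (parcs T) v"
  shows "\<exists>H \<in> F_family. T \<simeq>\<^sub>g H"
proof -
  obtain w p q u a b L where F: "distinct (vlist v ((w, p, q) # (u, a, b) # L))"
      "pverts T = set (vlist v ((w, p, q) # (u, a, b) # L))"
      "parcs T = spider_arcs v ((w, p, q) # L) \<union> leg_arcs w (u, a, b)"
    using assms unfolding F_like_def by blast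
  let ?L = "(w, p, q) # (u, a, b) # L"
  let ?k = "length ?L"
  \<comment> \<open>The displaced leg is put back at the centre, which gives a \<open>T_k\<close>;
    its first two legs then start at the numbers \<open>?k + 1\<close> and
    \<open>?k + 2\<close>.\<close>
  have "T_like (pverts T) (spider_arcs v ?L) v ?L" using F unfolding T_like_def by simp
  then obtain g where g: "inj_on g {0..3 * ?k}" "pverts T = g ` {0..3 * ?k}"
    "spider_arcs v ?L = map_prod g g ` parcs (T_graph ?k)" "g 0 = v"
    "\<And>i. i < ?k \<Longrightarrow> g (?k + Suc i) = fst (?L ! i)"
    using T_like_numbering[of "pverts T" "spider_arcs v ?L" v ?L] by blast
  have gw: "g (?k + 1) = w" using g(5)[of 0] by simp
  have gu: "g (?k + 2) = u" using g(5)[of 1] by (simp add: numeral_2_eq_2)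
  let ?H = "replace_edge (T_graph ?k) (?k + 2) 0 (?k + 1)"
  have "parcs T = (spider_arcs v ?L - {(u, v), (v, u)}) \<union> {(u, w), (w, u)}"
    using F(1) spider_arcs_in_vlist[of v L] unfolding F(3) by auto
  also have "spider_arcs v ?L - {(u, v), (v, u)} =
      map_prod g g ` (parcs (T_graph ?k) - {(?k + 2, 0), (0, ?k + 2)})"
  proof -
    have "inj_on (map_prod g g) ({0..3 * ?k} \<times> {0..3 * ?k})"
      using map_prod_inj_on[OF g(1) g(1)] .
    then have "map_prod g g ` (parcs (T_graph ?k) - {(?k + 2, 0), (0, ?k + 2)}) =
        map_prod g g ` parcs (T_graph ?k) - map_prod g g ` {(?k + 2, 0), (0, ?k + 2)}"
      using T_graph_arcs_in_verts[of ?k]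
      by (intro inj_on_image_set_diff) (auto simp: T_graph_explicit(1))
    then show ?thesis using gu g(3,4) by simp
  qed
  finally have E: "parcs T = map_prod g g ` parcs ?H"
    using gw gu by (simp add: replace_edge_def image_Un)
  have "T \<simeq>\<^sub>g ?H"
    using g E T_graph_arcs_in_verts[of ?k]
    by (intro graph_isoI[of g]) (auto simp: replace_edge_def T_graph_explicit(1))
  moreover have "?H \<in> F_family"
  proof -
    have "1 \<in> {1..?k}" "2 \<in> {1..?k}" by auto
    then have "(?k + 2, 0) \<in> parcs (T_graph ?k)" "(?k + 1, 0) \<in> parcs (T_graph ?k)"
      unfolding T_graph_explicit by blast+
    moreover have "2 \<le> ?k" "?k + 1 \<noteq> ?k + 2" by simp_all
    ultimately show ?thesis unfolding F_family_def by blast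
  qed
  ultimately show ?thesis by blast
qed

lemma star3_explicit:
  "pverts (star_graph 3) = {0, 1, 2, 3}"
  "parcs (star_graph 3) = {(0, 1), (1, 0), (0, 2), (2, 0), (0, 3), (3, 0)}"
  unfolding star_graph_def by auto

lemma T_ast_explicit:
  "pverts T_ast = {0, 1, 2, 3, 4, 5, 6}"
  "parcs T_ast = {(0, 2), (2, 0), (0, 3), (3, 0), (0, 4), (4, 0), (4, 5), (5, 4), (5, 6), (6, 5), (6, 1), (1, 6)}"
  unfolding T_ast_def subdivide.simps pair_pre_digraph.simps star3_explicit by auto

lemma K13_like_iso:
  assumes "K13_like (pverts T) (parcs T)"
  shows "T \<simeq>\<^sub>g star_graph 3"
proof -
  obtain a b c d where "distinct [a, b, c, d]" "pverts T = {a, b, c, d}"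
     "parcs T = {(a, b), (b, a), (a, c), (c, a), (a, d), (d, a)}"
    using assms unfolding K13_like_def by blast
  then show ?thesis
    by (intro graph_isoI[of "(!) [a, b, c, d]"]) (auto simp: star3_explicit inj_on_def)
qed

lemma T_ast_like_iso:
  assumes "T_ast_like (pverts T) (parcs T)"
  shows "T \<simeq>\<^sub>g T_ast"
proof -
  obtain a b c d e f g where "distinct [a, b, c, d, e, f, g]" "pverts T = {a, b, c, d, e, f, g}"
     "parcs T = {(a, b), (b, a), (a, c), (c, a), (a, d), (d, a), (d, e), (e, d), (e, f), (f, e), (f, g), (g, f)}"
    using assms unfolding T_ast_like_def by blast
  \<comment> \<open>In \<open>T_ast\<close> the subdivided edge runs through 0, 4, 5, 6, 1, so the
    end \<open>g\<close> of the long branch gets number 1.\<close>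
  then show ?thesis
    by (intro graph_isoI[of "(!) [a, g, b, c, d, e, f]"]) (auto simp: T_ast_explicit inj_on_def)
qed

lemma extremal_like_iso:
  assumes "extremal_like (pverts T) (parcs T)"
  shows "\<exists>H \<in> T_family \<union> F_family \<union> {star_graph 3, T_ast}. T \<simeq>\<^sub>g H"
proof -
  have "T_graph (length L) \<in> T_family" if "L \<noteq> []" for L :: "('a \<times> 'a \<times> 'a) list"
    using that unfolding T_family_def by (auto intro!: exI[of _ "length L"] simp: Suc_leI)
  then show ?thesis
    using assms T_like_iso[of T] F_like_iso[of T] K13_like_iso[of T] T_ast_like_iso[of T]
    unfolding extremal_like_def by blast
qed

lemma path_arcs_nth:
  "path_arcs xs = {(xs ! i, xs ! j) | i j. i < length xs \<and> j < length xs \<and> (j = Suc i \<or> i = Suc j)}"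
proof (induction xs rule: path_arcs.induct)
  case (1 x y xs)
  let ?R = "\<lambda>zs :: 'a list. {(zs ! i, zs ! j) | i j. i < length zs \<and> j < length zs \<and> (j = Suc i \<or> i = Suc j)}"
  have "?R (x # y # xs) = {(x, y), (y, x)} \<union> ?R (y # xs)"
  proof (intro equalityI subsetI)
    fix e assume "e \<in> ?R (x # y # xs)"
    then obtain i j where ij: "e = ((x # y # xs) ! i, (x # y # xs) ! j)" "i < length (x # y # xs)"
      "j < length (x # y # xs)" "j = Suc i \<or> i = Suc j" by blast
    show "e \<in> {(x, y), (y, x)} \<union> ?R (y # xs)"
    proof (cases "i = 0 \<or> j = 0")
      case True
      then show ?thesis using ij by auto
    next
      case False
      then obtain i' j' where "i = Suc i'" "j = Suc j'" by (metis not0_implies_Suc)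
      then show ?thesis using ij by auto
    qed
  next
    fix e assume "e \<in> {(x, y), (y, x)} \<union> ?R (y # xs)"
    then consider "e = (x, y)" | "e = (y, x)" | i j where "e = ((y # xs) ! i, (y # xs) ! j)"
      "i < length (y # xs)" "j < length (y # xs)" "j = Suc i \<or> i = Suc j" by blast
    then show "e \<in> ?R (x # y # xs)"
    proof cases
      case 1
      then show ?thesis by (intro CollectI exI[of _ 0] exI[of _ 1]) simp
    next
      case 2
      then show ?thesis by (intro CollectI exI[of _ 1] exI[of _ 0]) simp
    next
      case (3 i j)
      then show ?thesis by (intro CollectI exI[of _ "Suc i"] exI[of _ "Suc j"]) auto
    qed
  qed
  then show ?case using 1 by simp
qed auto

lemma path_like_iso:
  assumes "path_like (pverts T) (parcs T) n"
  shows "T \<simeq>\<^sub>g path_graph n"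
proof -
  obtain xs where xs: "length xs = n" "distinct xs" "pverts T = set xs" "parcs T = path_arcs xs"
    using assms unfolding path_like_def by blast
  have "inj_on ((!) xs) {..<n}" using xs(1,2) by (auto simp: inj_on_def nth_eq_iff_index_eq)
  moreover have "set xs = (!) xs ` {..<n}" using xs(1) by (auto simp: set_conv_nth)
  moreover have "path_arcs xs = map_prod ((!) xs) ((!) xs) `
      {(i, j). i < n \<and> j < n \<and> (j = Suc i \<or> i = Suc j)}"
    unfolding path_arcs_nth xs(1) by (auto simp: image_def)
  ultimately show ?thesis using xs
    by (intro graph_isoI[of "(!) xs"]) (auto simp: path_graph_def)
qed

section \<open>Lower bounds\<close>

text \<open>For a leg \<open>x\<close>, \<open>y\<close>, \<open>z\<close>: at most \<open>x\<close>
  is two steps from the leaf \<open>z\<close>, which is too few, so \<open>z\<close> needs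
  \<open>y\<close>. Whatever is two steps from \<open>y\<close> is a neighbour of
  \<open>x\<close>.\<close>

lemma leg_in_dominating_set:
  assumes "dominated E S z" "dominated E S y" "finite S"
    and z: "\<And>s. (z, s) \<in> E \<Longrightarrow> s = y" and y: "\<And>s. (y, s) \<in> E \<Longrightarrow> s = x \<or> s = z"
  shows "y \<in> S" "x \<in> S \<or> z \<in> S \<or> 2 \<le> card (S \<inter> {s. s \<noteq> y \<and> (x, s) \<in> E})"
proof -
  have "two_steps E z \<subseteq> {x}" using z y unfolding two_steps_def by blast
  then have "card (S \<inter> two_steps E z) \<le> card {x}" by (intro card_mono) auto
  then show "y \<in> S" using assms(1) z unfolding dominated_def by auto
  have "two_steps E y \<subseteq> {s. s \<noteq> y \<and> (x, s) \<in> E}" using z y unfolding two_steps_def by blast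
  then have "card (S \<inter> two_steps E y) \<le> card (S \<inter> {s. s \<noteq> y \<and> (x, s) \<in> E})"
    using assms(3) by (intro card_mono) auto
  then show "x \<in> S \<or> z \<in> S \<or> 2 \<le> card (S \<inter> {s. s \<noteq> y \<and> (x, s) \<in> E})"
    using assms(2) y unfolding dominated_def by auto
qed

lemma card_ge_disjoint_family:
  assumes "finite S" "\<And>i. i \<in> {1..k} \<Longrightarrow> 2 \<le> card (S \<inter> A i)"
    and "\<And>i j. i \<in> {1..k} \<Longrightarrow> j \<in> {1..k} \<Longrightarrow> i \<noteq> j \<Longrightarrow> A i \<inter> A j = {}"
  shows "2 * k \<le> card S"
proof -
  have "2 * k = (\<Sum>i \<in> {1..k}. 2)" by simp
  also have "\<dots> \<le> (\<Sum>i \<in> {1..k}. card (S \<inter> A i))" using assms(2) by (intro sum_mono) auto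
  also have "\<dots> = card (\<Union>i \<in> {1..k}. S \<inter> A i)"
  proof -
    have "\<forall>i \<in> {1..k}. \<forall>j \<in> {1..k}. i \<noteq> j \<longrightarrow> (S \<inter> A i) \<inter> (S \<inter> A j) = {}" using assms(3) by blast
    then show ?thesis using assms(1) by (intro card_UN_disjoint[symmetric]) simp_all
  qed
  also have "\<dots> \<le> card S" using assms(1) by (intro card_mono) auto
  finally show ?thesis .
qed

lemma card_Int_ge_2: "finite S \<Longrightarrow> a \<in> S \<Longrightarrow> b \<in> S \<Longrightarrow> a \<noteq> b \<Longrightarrow> {a, b} \<subseteq> A \<Longrightarrow> 2 \<le> card (S \<inter> A)"
  using card_mono[of "S \<inter> A" "{a, b}"] by simp

definition dominating :: "'a pair_pre_digraph \<Rightarrow> 'a set \<Rightarrow> bool" where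
  "dominating G S \<longleftrightarrow> S \<subseteq> pverts G \<and> (\<forall>v \<in> pverts G. dominated (parcs G) S v)"

text \<open>Each leg needs its middle vertex and one more, as the centre is the only other neighbour
  of its first vertex.\<close>

lemma T_graph_lower:
  assumes "dominating (T_graph k) S"
  shows "2 * k \<le> card S"
proof -
  let ?E = "parcs (T_graph k)"
  have S: "S \<subseteq> {0..3 * k}" "\<And>v. v \<le> 3 * k \<Longrightarrow> dominated ?E S v"
    using assms unfolding dominating_def T_graph_explicit(1) by auto
  then have fin: "finite S" using finite_subset by blast
  show ?thesis
  proof (rule card_ge_disjoint_family[OF fin, of k "\<lambda>i. {k + i, 2 * k + i, i}"])
    fix i assume i: "i \<in> {1..k}"
    have leg: "2 * k + i \<in> S" "k + i \<in> S \<or> i \<in> S \<or> 2 \<le> card (S \<inter> {s. s \<noteq> 2 * k + i \<and> (k + i, s) \<in> ?E})"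
      by (rule leg_in_dominating_set[of ?E S i "2 * k + i" "k + i"]; use i S fin in
          \<open>auto simp: T_graph_explicit(2)\<close>)+
    have "{s. s \<noteq> 2 * k + i \<and> (k + i, s) \<in> ?E} \<subseteq> {0}" using i by (auto simp: T_graph_explicit(2))
    then have "card (S \<inter> {s. s \<noteq> 2 * k + i \<and> (k + i, s) \<in> ?E}) \<le> card {0 :: nat}"
      by (intro card_mono) auto
    then have "k + i \<in> S \<or> i \<in> S" using leg by auto
    then show "2 \<le> card (S \<inter> {k + i, 2 * k + i, i})"
      using leg(1) i by (auto intro: card_Int_ge_2[OF fin])
  qed auto
qed

text \<open>Only the first vertex of leg \<open>l\<close> has two neighbours outside its leg, the
  centre and \<open>k + m\<close>. If leg \<open>l\<close> contains just its middle vertex, both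
  must be in \<open>S\<close>, and the centre is counted for this leg; the sets stay
  disjoint.\<close>

lemma F_graph_lower:
  assumes "dominating (replace_edge (T_graph k) (k + m) 0 (k + l)) S"
    and ml: "m \<in> {1..k}" "l \<in> {1..k}" "l \<noteq> m"
  shows "2 * k \<le> card S"
proof -
  let ?E = "parcs (replace_edge (T_graph k) (k + m) 0 (k + l))"
  have E: "?E = (parcs (T_graph k) - {(k + m, 0), (0, k + m)}) \<union> {(k + m, k + l), (k + l, k + m)}"
    by (simp add: replace_edge_def)
  have S: "S \<subseteq> {0..3 * k}" "\<And>v. v \<le> 3 * k \<Longrightarrow> dominated ?E S v"
    using assms(1) unfolding dominating_def by (auto simp: replace_edge_def T_graph_explicit(1))
  then have fin: "finite S" using finite_subset by blast
  show ?thesis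
  proof (rule card_ge_disjoint_family[OF fin, of k
        "\<lambda>i. {k + i, 2 * k + i, i} \<union> (if i = l then {0} else {})"])
    fix i assume i: "i \<in> {1..k}"
    let ?A = "{k + i, 2 * k + i, i} \<union> (if i = l then {0} else {})"
    have leg: "2 * k + i \<in> S" "k + i \<in> S \<or> i \<in> S \<or> 2 \<le> card (S \<inter> {s. s \<noteq> 2 * k + i \<and> (k + i, s) \<in> ?E})"
      by (rule leg_in_dominating_set[of ?E S i "2 * k + i" "k + i"]; use i ml S fin in
          \<open>auto simp: E T_graph_explicit(2)\<close>)+
    have "k + i \<in> S \<or> i \<in> S \<or> i = l \<and> 0 \<in> S"
    proof (rule ccontr)
      assume neg: "\<not> ?thesis"
      have "S \<inter> {s. s \<noteq> 2 * k + i \<and> (k + i, s) \<in> ?E} \<subseteq> {if i = m then k + l else if i = l then k + m else 0}"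
        using i ml neg unfolding E by (auto simp: T_graph_explicit(2))
      then have "card (S \<inter> {s. s \<noteq> 2 * k + i \<and> (k + i, s) \<in> ?E}) \<le>
          card {if i = m then k + l else if i = l then k + m else 0}"
        by (intro card_mono) auto
      then show False using leg(2) neg by auto
    qed
    then show "2 \<le> card (S \<inter> ?A)"
      using leg(1) i by (auto intro: card_Int_ge_2[OF fin])
  qed auto
qed

lemma star_graph_lower:
  assumes "dominating (star_graph 3) S"
  shows "2 \<le> card S"
proof -
  have fin: "finite S"
    using assms finite_subset unfolding dominating_def star3_explicit by blast
  have le: "card (S \<inter> two_steps (parcs (star_graph 3)) v) \<le> card S" for v
    using fin by (intro card_mono) auto
  have "dominated (parcs (star_graph 3)) S 0" "dominated (parcs (star_graph 3)) S 1"
    using assms unfolding dominating_def star3_explicit(1) by auto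
  then consider "2 \<le> card S" | "0 \<in> S" "1 \<in> S \<or> 2 \<in> S \<or> 3 \<in> S"
    using le order_trans unfolding dominated_def star3_explicit(2) by (smt (verit) insert_iff Pair_inject empty_iff zero_neq_one)
  then show ?thesis
  proof cases
    case 2
    then show ?thesis using card_Int_ge_2[OF fin, of 0 _ UNIV] by auto
  qed
qed

text \<open>Two vertices are needed among 1, 5, 6 at the far end of the long branch, and two among
  0, 2, 3, 4: the leaf 2 needs 0 or both 3 and 4, and the centre 0 needs a neighbour, since only 5
  is two steps away.\<close>

lemma T_ast_lower:
  assumes "dominating T_ast S"
  shows "4 \<le> card S"
proof -
  let ?E = "parcs T_ast"
  have fin: "finite S"
    using assms finite_subset unfolding dominating_def T_ast_explicit by blast
  have dom: "\<And>v. v \<in> {0, 1, 2, 3, 4, 5, 6} \<Longrightarrow> dominated ?E S v"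
    using assms unfolding dominating_def T_ast_explicit(1) by auto
  have leg: "6 \<in> S" "5 \<in> S \<or> 1 \<in> S \<or> 2 \<le> card (S \<inter> {s. s \<noteq> 6 \<and> (5, s) \<in> ?E})"
    by (rule leg_in_dominating_set[of ?E S 1 6 5]; use dom fin in \<open>auto simp: T_ast_explicit(2)\<close>)+
  have "{s. s \<noteq> 6 \<and> (5, s) \<in> ?E} = {4}" by (auto simp: T_ast_explicit(2))
  then have "card (S \<inter> {s. s \<noteq> 6 \<and> (5, s) \<in> ?E}) \<le> 1"
    using card_mono[of "{4}" "S \<inter> {4}"] by simp
  then have A: "2 \<le> card (S \<inter> {1, 5, 6})"
    using leg by (auto intro: card_Int_ge_2[OF fin])
  have two: "x \<in> S" if "2 \<le> card (S \<inter> {x, y})" for x y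
    using that card_mono[of "{y}" "S \<inter> {x, y}"] by (cases "x \<in> S") auto
  have N: "(2, x) \<in> ?E \<Longrightarrow> x = 0" "(0, x) \<in> ?E \<Longrightarrow> x \<in> {2, 3, 4}"
      "(3, x) \<in> ?E \<Longrightarrow> x = 0" "(4, x) \<in> ?E \<Longrightarrow> x \<in> {0, 5}" for x
    by (simp_all add: T_ast_explicit(2))
  have "two_steps ?E 2 \<subseteq> {3, 4}" unfolding two_steps_def using N(1,2) by blast
  then have "card (S \<inter> two_steps ?E 2) \<le> card (S \<inter> {3, 4})" by (intro card_mono) auto
  then have "0 \<in> S \<or> 2 \<le> card (S \<inter> {3, 4})"
    using dom[of 2] N(1) unfolding dominated_def by fastforce
  then have "0 \<in> S \<or> 3 \<in> S \<and> 4 \<in> S"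
    using two[of 3 4] two[of 4 3] by (metis insert_commute)
  moreover have "2 \<in> S \<or> 3 \<in> S \<or> 4 \<in> S"
  proof -
    have "two_steps ?E 0 \<subseteq> {5}" unfolding two_steps_def using N by blast
    then have "card (S \<inter> two_steps ?E 0) \<le> card {5 :: nat}" by (intro card_mono) auto
    then show ?thesis using dom[of 0] N(2) unfolding dominated_def by fastforce
  qed
  ultimately have B: "2 \<le> card (S \<inter> {0, 2, 3, 4})"
    by (auto intro: card_Int_ge_2[OF fin])
  have "card (S \<inter> {1, 5, 6} \<union> S \<inter> {0, 2, 3, 4}) = card (S \<inter> {1, 5, 6}) + card (S \<inter> {0, 2, 3, 4})"
    by (intro card_Un_disjoint) auto
  moreover have "card (S \<inter> {1, 5, 6} \<union> S \<inter> {0, 2, 3, 4}) \<le> card S"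
    using fin by (intro card_mono) auto
  ultimately show ?thesis using A B by linarith
qed

lemma extremal_lower:
  assumes "H \<in> T_family \<union> F_family \<union> {star_graph 3, T_ast}" "dominating H S"
  shows "2 * card (pverts H) \<le> 3 * card S + 2"
proof -
  from assms(1) consider k where "H = T_graph k"
    | k u w where "H = replace_edge (T_graph k) u 0 w" "(u, 0) \<in> parcs (T_graph k)"
      "(w, 0) \<in> parcs (T_graph k)" "w \<noteq> u"
    | "H = star_graph 3" | "H = T_ast"
    unfolding T_family_def F_family_def by blast
  then show ?thesis
  proof cases
    case 1
    then show ?thesis using T_graph_lower assms(2) by (fastforce simp: T_graph_explicit(1))
  next
    case (2 k u w)
    obtain m l where "u = k + m" "m \<in> {1..k}" "w = k + l" "l \<in> {1..k}"
      using 2(2,3) unfolding T_graph_explicit(2) by auto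
    then have "2 * k \<le> card S" using F_graph_lower[of k m l S] 2 assms(2) by auto
    then show ?thesis unfolding 2(1) replace_edge_def by (simp add: T_graph_explicit(1))
  next
    case 3
    then show ?thesis using star_graph_lower assms(2) by (auto simp: star3_explicit(1))
  next
    case 4
    then show ?thesis using T_ast_lower assms(2) by (auto simp: T_ast_explicit(1))
  qed
qed

section \<open>Transfer along isomorphisms and conclusion\<close>

lemma dominating_iso:
  assumes "G \<simeq>\<^sub>g H" "dominating G S" "finite (pverts G)" "parcs G \<subseteq> pverts G \<times> pverts G"
  shows "\<exists>S'. dominating H S' \<and> card S' = card S \<and> card (pverts H) = card (pverts G)"
proof -
  obtain f where f: "inj_on f (pverts G)" "pverts H = f ` pverts G" "parcs H = map_prod f f ` parcs G"
    using graph_isoD[OF assms(1)] by blast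
  have S: "S \<subseteq> pverts G" using assms(2) unfolding dominating_def by blast
  then have "finite S" using assms(3) finite_subset by blast
  then have "dominating H (f ` S)"
    using assms f S dominated_image[OF f(1) assms(4) S] unfolding dominating_def by auto
  moreover have "card (f ` S) = card S" "card (pverts H) = card (pverts G)"
    using f S by (auto intro: card_image inj_on_subset)
  ultimately show ?thesis by blast
qed

theorem mainTheorem4:
  fixes T :: "'a pair_pre_digraph" and n :: nat
  assumes "tree_graph T"
    and "card (pverts T) = n"
    and "n \<ge> 4"
    and "\<not> (\<exists>P \<in> {path_graph 5, path_graph 6}. T \<simeq>\<^sub>g P)"
  shows "real (\<gamma>\<^sub>t\<^sup>d T) \<le> 2 * (real n - 1) / 3 \<and>
    (real (\<gamma>\<^sub>t\<^sup>d T) = 2 * (real n - 1) / 3 \<longleftrightarrow>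
      (\<exists>H \<in> T_family \<union> F_family \<union> {star_graph 3, T_ast}. T \<simeq>\<^sub>g H))"
proof -
  interpret T: pair_graph T using assms(1) unfolding tree_graph_def by blast
  have dtd: "disj_total_dominating T S \<longleftrightarrow> dominating T S" for S
    using disj_total_dominating_iff[OF assms(1)] unfolding dominating_def by blast
  obtain r t where t: "wft (Jn (Lf r) t)" "rverts (Jn (Lf r) t) = pverts T" "rarcs (Jn (Lf r) t) = parcs T"
    using tree_graph_leaf_rtree[OF assms(1)] assms(2,3) by auto
  have upper: "3 * int (\<gamma>\<^sub>t\<^sup>d T) \<le> 2 * int n + z \<and> (\<exists>S. dominating T S \<and> card S = \<gamma>\<^sub>t\<^sup>d T)"
    if bound: "bounded_at (shape_of t) z" for z
  proof -
    obtain S where S: "dominating T S" "3 * int (card S) \<le> 2 * int n + z"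
      using bounded_dominating_set[OF t(1) bound] assms(2) unfolding t dominating_def by blast
    then have "\<gamma>\<^sub>t\<^sup>d T \<le> card S"
      unfolding disj_total_domination_number_def dtd by (auto intro: Least_le)
    moreover have "\<exists>S'. dominating T S' \<and> card S' = \<gamma>\<^sub>t\<^sup>d T"
      unfolding disj_total_domination_number_def dtd by (rule LeastI[of _ "card S"]) (use S in blast)
    ultimately show ?thesis using S by auto
  qed
  have not_path: "shape_of t \<notin> {Path1, Path2, Path4, Path5}"
  proof
    assume "shape_of t \<in> {Path1, Path2, Path4, Path5}"
    from shape_path[OF this t(1)]
    have "card (pverts T) \<le> 3 \<or> path_like (pverts T) (parcs T) 5 \<or> path_like (pverts T) (parcs T) 6"
      unfolding t(2,3) .
    moreover have "\<not> card (pverts T) \<le> 3" using assms(2,3) by simp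
    ultimately show False using assms(4) path_like_iso by blast
  qed
  have lower: "2 * n \<le> 3 * \<gamma>\<^sub>t\<^sup>d T + 2"
    if H: "H \<in> T_family \<union> F_family \<union> {star_graph 3, T_ast}" "T \<simeq>\<^sub>g H"
      and S: "dominating T S" "card S = \<gamma>\<^sub>t\<^sup>d T" for H S
  proof -
    have "parcs T \<subseteq> pverts T \<times> pverts T" using T.in_arcsD1 T.in_arcsD2 by auto
    then obtain S' where S': "dominating H S'" "card S' = card S" "card (pverts H) = card (pverts T)"
      using dominating_iso[OF H(2) S(1) T.pair_finite_verts] by blast
    then show ?thesis using extremal_lower[OF H(1) S'(1)] S(2) assms(2) by simp
  qed
  show ?thesis
  \<comment> \<open>This split separates equality from strict inequality: these four classes yield
    extremal trees, and elsewhere the value is at most -3, which by \<open>lower\<close> excludes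
    every extremal graph.\<close>
  proof (cases "shape_of t \<in> {Path3, Cherry, Fork, Missing1}")
    case True
    then have iso: "\<exists>H \<in> T_family \<union> F_family \<union> {star_graph 3, T_ast}. T \<simeq>\<^sub>g H"
      using extremal_like_iso[of T] shape_extremal[OF True t(1)] unfolding t by blast
    have "bounded_at (shape_of t) (-2)" using True shapes_bounded(2) by auto
    then have "3 * int (\<gamma>\<^sub>t\<^sup>d T) \<le> 2 * int n - 2" "\<exists>S. dominating T S \<and> card S = \<gamma>\<^sub>t\<^sup>d T"
      using upper by force+
    moreover from this(2) have "2 * n \<le> 3 * \<gamma>\<^sub>t\<^sup>d T + 2" using lower iso by blast
    ultimately have "3 * \<gamma>\<^sub>t\<^sup>d T + 2 = 2 * n" by linarith
    then have "real (3 * \<gamma>\<^sub>t\<^sup>d T + 2) = real (2 * n)" by (rule arg_cong)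
    then have "real (\<gamma>\<^sub>t\<^sup>d T) = 2 * (real n - 1) / 3" by simp
    then show ?thesis using iso by simp
  next
    case False
    then have "bounded_at (shape_of t) (-3)"
      using not_path shapes_bounded(1) by (cases "shape_of t") auto
    then have u: "3 * int (\<gamma>\<^sub>t\<^sup>d T) \<le> 2 * int n - 3" "\<exists>S. dominating T S \<and> card S = \<gamma>\<^sub>t\<^sup>d T"
      using upper by force+
    then have "\<not> (\<exists>H \<in> T_family \<union> F_family \<union> {star_graph 3, T_ast}. T \<simeq>\<^sub>g H)"
      using lower by force
    moreover have "real (\<gamma>\<^sub>t\<^sup>d T) < 2 * (real n - 1) / 3"
    proof -
      have "3 * \<gamma>\<^sub>t\<^sup>d T + 3 \<le> 2 * n" using u(1) by linarith
      then have "real (3 * \<gamma>\<^sub>t\<^sup>d T + 3) \<le> real (2 * n)" by (rule of_nat_mono)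
      then show ?thesis by simp
    qed
    ultimately show ?thesis by simp
  qed
qed

end
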